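(* There is a constant $A$ such that the following holds for all integers $n\ge1$, $T\ge1$ and all $0\le p\le 1$. Let $\mathcal C=\mathcal X_0^T$ be the classical circuit on one bit consisting of $T$ idle operations, and let $FT^n(\mathcal C)$ be its $n$-fold repeated fault-tolerant simulation. If $FT^n(\mathcal C)$ is subject to a $p$-bounded gadget error model, then the simulated circuit $\mathcal C$ experiences an $(Ap)^{2^{n-1}}$-bounded wire error model.
   Context: **Elementary gadgets** on a line of bits: $\mathcal X_0$ (one bit, identity); $\mathcal Y_0$ (two adjacent bits, swap); $\mathcal Z_0$ (three adjacent bits, replaces each of the three bits by the majority of the three). **Level-1 gadgets.** $\mathcal X_1$ acts on $3$ bits by $\mathcal X_0$ on each bit, with the same number of layers as $\mathcal Y_1$. $\mathcal Y_1$ acts on $6$ bits and swaps the first block of three with the second, bit by bit, by the diamond pattern of nearest-neighbour swaps on positions: layer 1: $(3,4)$; layer 2: $(2,3),(4,5)$; layer 3: $(1,2),(3,4),(5,6)$; layer 4: $(2,3),(4,5)$; layer 5: $(3,4)$; all other bits idle. $\mathcal Z_1$ acts on $9$ bits (three blocks of three): first a fixed five-layer circuit of nearest-neighbour swaps $\mathcal Y_0$ and idles $\mathcal X_0$ realizing the permutation sending the $j$-th bit of block $i$ to the $i$-th position of block $j$; then $\mathcal Z_0$ on each of the three blocks; then again a fixed five-layer circuit of swaps and idles realizing the same permutation. **Fault-tolerant simulation.** Let $EC_1=\mathcal Z_0$. For a circuit $\mathcal C$ of gadgets $\mathcal X_0,\mathcal Y_0,\mathcal Z_0$, $FT(\mathcal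 C)$ is obtained by replacing each bit by a block of $3$ bits and each gadget $\mathcal G_0$ by $\mathcal G_1$, with one layer of $EC_1$ gadgets (one per block) before the first layer of gates, between consecutive layers of gates, and after the last layer of gates. $FT^0(\mathcal C)=\mathcal C$ and $FT^n(\mathcal C)=FT(FT^{n-1}(\mathcal C))$. **Decoder.** $D_1=\mathrm{Maj}$ on three bits, and $D_n$ on $3^n$ bits is $\mathrm{Maj}$ of $D_{n-1}$ of the three consecutive blocks of length $3^{n-1}$. **Gadget error model.** Both wires (the states of bits at inputs/outputs of elementary gadgets) and elementary gadgets can fail; a failing wire may be flipped and a failing gadget may produce an arbitrary output on the bits it acts on. With $F$ the random set of failed components, the model is $p$-bounded if $\mathbb P[M\subseteq F]\le p^{|M|}$ for every set $M$ of components. **"The simulated circuit $\mathcal C$ experiences a $q$-bounded wire error model"** means: the value obtained by applying $D_n$ to the noisy output of $FT^n(\mathcal C)$ started from an encoded input ($0^{3^n}$ or $1^{3^n}$) equals the output of $\mathcal C$, started from the corresponding bit, with perfect gadgets and with bit flips on wires of $\mathcal C$ contained in a random set $E'$ with $\mathbb P[W\subseteq E']\le q^{|W|}$ for all sets $W$ of wires of $\mathcal C$. *)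

theory Defs
  imports "HOL-Probability.Probability"
begin

section \<open>Circuits on a line of bits\<close>

datatype gadget = X0 | Y0 | Z0

fun arity :: "gadget \<Rightarrow> nat" where
  "arity X0 = 1"
| "arity Y0 = 2"
| "arity Z0 = 3"

definition maj :: "bool \<Rightarrow> bool \<Rightarrow> bool \<Rightarrow> bool" where
  "maj a b c \<longleftrightarrow> (a \<and> b) \<or> (b \<and> c) \<or> (a \<and> c)"

fun gadget_map :: "gadget \<Rightarrow> bool list \<Rightarrow> bool list" where
  "gadget_map X0 [a] = [a]"
| "gadget_map Y0 [a, b] = [b, a]"
| "gadget_map Z0 [a, b, c] = [maj a b c, maj a b c, maj a b c]"
| "gadget_map _ xs = xs"

text \<open>
  A layer lists its gadgets from left to right; consecutive gadgets act on consecutive groups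
  of bits, so the list tiles the line and idle bits carry an explicit \<open>X0\<close>.
  A circuit is a list of layers, in temporal order. Bits and layers are numbered from 0.
\<close>

type_synonym layer = "gadget list"
type_synonym circuit = "layer list"

definition width :: "layer \<Rightarrow> nat" where
  "width L = sum_list (map arity L)"

fun run_layer :: "layer \<Rightarrow> bool list \<Rightarrow> bool list" where
  "run_layer [] xs = xs"
| "run_layer (g # L) xs = gadget_map g (take (arity g) xs) @ run_layer L (drop (arity g) xs)"

definition run :: "circuit \<Rightarrow> bool list \<Rightarrow> bool list" where
  "run C xs = fold run_layer C xs"


section \<open>Level-1 gadgets and fault-tolerant simulation\<close>

definition Y1 :: circuit where
  "Y1 = [[X0, X0, Y0, X0, X0],
         [X0, Y0, Y0, X0],
         [Y0, Y0, Y0],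
         [X0, Y0, Y0, X0],
         [X0, X0, Y0, X0, X0]]"

definition X1 :: circuit where
  "X1 = replicate (length Y1) [X0, X0, X0]"

text \<open>
  The five-layer circuits admissible as the first and third part of the level-1 majority gadget:
  swaps and idles on 9 bits that send bit \<open>j\<close> of block \<open>i\<close> to position \<open>i\<close> of block \<open>j\<close>. Several
  circuits do this; everything below is parametrised by the two that are used.
\<close>

definition block_transposer :: "circuit \<Rightarrow> bool" where
  "block_transposer P \<longleftrightarrow>
     length P = 5 \<and>
     (\<forall>L\<in>set P. set L \<subseteq> {X0, Y0} \<and> width L = 9) \<and>
     (\<forall>xs. length xs = 9 \<longrightarrow>
        (\<forall>i<3. \<forall>j<3. run P xs ! (3 * j + i) = xs ! (3 * i + j)))"

definition Z1 :: "circuit \<Rightarrow> circuit \<Rightarrow> circuit" where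
  "Z1 P Q = P @ [[Z0, Z0, Z0]] @ Q"

fun level1 :: "circuit \<Rightarrow> circuit \<Rightarrow> gadget \<Rightarrow> circuit" where
  "level1 P Q X0 = X1"
| "level1 P Q Y0 = Y1"
| "level1 P Q Z0 = Z1 P Q"

text \<open>
  The level-1 gadgets of one layer run in parallel, shorter ones being padded with idle layers.
  The padding only matters for layers that contain \<open>Z0\<close> together with \<open>X0\<close> or \<open>Y0\<close>, and such
  layers never arise in the repeated simulation of an idle circuit (\<open>FTn_layers_unmixed\<close>).
\<close>

definition level1_layer :: "circuit \<Rightarrow> circuit \<Rightarrow> nat \<Rightarrow> gadget \<Rightarrow> layer" where
  "level1_layer P Q s g =
     (if s < length (level1 P Q g) then level1 P Q g ! s else replicate (3 * arity g) X0)"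

definition simulate_layer :: "circuit \<Rightarrow> circuit \<Rightarrow> layer \<Rightarrow> circuit" where
  "simulate_layer P Q L =
     map (\<lambda>s. concat (map (level1_layer P Q s) L))
       [0..<Max (insert 0 ((\<lambda>g. length (level1 P Q g)) ` set L))]"

text \<open>\<open>N\<close> is the number of bits of \<open>C\<close>, that is, the number of blocks of \<open>FT P Q N C\<close>.\<close>

definition FT :: "circuit \<Rightarrow> circuit \<Rightarrow> nat \<Rightarrow> circuit \<Rightarrow> circuit" where
  "FT P Q N C =
     replicate N Z0 # concat (map (\<lambda>L. simulate_layer P Q L @ [replicate N Z0]) C)"

fun FTn :: "circuit \<Rightarrow> circuit \<Rightarrow> nat \<Rightarrow> nat \<Rightarrow> circuit \<Rightarrow> circuit" where
  "FTn P Q 0 N C = C"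
| "FTn P Q (Suc n) N C = FT P Q (3 ^ n * N) (FTn P Q n N C)"

fun decode :: "nat \<Rightarrow> bool list \<Rightarrow> bool" where
  "decode 0 xs = xs ! 0"
| "decode (Suc n) xs =
     maj (decode n (take (3 ^ n) xs))
         (decode n (take (3 ^ n) (drop (3 ^ n) xs)))
         (decode n (take (3 ^ n) (drop (2 * 3 ^ n) xs)))"


section \<open>Noise\<close>

text \<open>
  \<open>Wire t i\<close> is bit \<open>i\<close> between layers \<open>t - 1\<close> and \<open>t\<close>; \<open>t = 0\<close> and \<open>t = length C\<close> are the inputs
  and the outputs of the circuit. \<open>Gadget t k\<close> is entry \<open>k\<close> of layer \<open>t\<close>.
\<close>

datatype component = Wire nat nat | Gadget nat nat

definition wires :: "nat \<Rightarrow> circuit \<Rightarrow> component set" where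
  "wires N C = {Wire t i | t i. t \<le> length C \<and> i < N}"

definition gadgets :: "circuit \<Rightarrow> component set" where
  "gadgets C = {Gadget t k | t k. t < length C \<and> k < length (C ! t)}"

definition circuit_components :: "nat \<Rightarrow> circuit \<Rightarrow> component set" where
  "circuit_components N C = wires N C \<union> gadgets C"

definition acts_on :: "layer \<Rightarrow> nat \<Rightarrow> nat set" where
  "acts_on L k = {width (take k L)..<width (take (Suc k) L)}"

definition noisy_wires :: "component set \<Rightarrow> nat \<Rightarrow> bool list \<Rightarrow> bool list \<Rightarrow> bool" where
  "noisy_wires F t u v \<longleftrightarrow>
     length v = length u \<and> (\<forall>i<length u. Wire t i \<notin> F \<longrightarrow> v ! i = u ! i)"

definition noisy_layer :: "component set \<Rightarrow> nat \<Rightarrow> layer \<Rightarrow> bool list \<Rightarrow> bool list \<Rightarrow> bool" where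
  "noisy_layer F t L v u \<longleftrightarrow>
     length u = length v \<and>
     (\<forall>k<length L. Gadget t k \<notin> F \<longrightarrow> (\<forall>i\<in>acts_on L k. u ! i = run_layer L v ! i))"

text \<open>
  \<open>possible_output F C x y\<close>: started from \<open>x\<close>, the circuit \<open>C\<close> can produce \<open>y\<close> if exactly the
  components in \<open>F\<close> are failing; their behaviour is adversarial. Here \<open>u t\<close> and \<open>v t\<close> are the bits
  before and after the possible flips on the wires at time \<open>t\<close>.
\<close>

definition possible_output ::
  "component set \<Rightarrow> circuit \<Rightarrow> bool list \<Rightarrow> bool list \<Rightarrow> bool" where
  "possible_output F C x y \<longleftrightarrow>
     (\<exists>u v. u 0 = x \<and>
        (\<forall>t\<le>length C. noisy_wires F t (u t) (v t)) \<and>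
        (\<forall>t<length C. noisy_layer F t (C ! t) (v t) (u (Suc t))) \<and>
        y = v (length C))"

text \<open>Circuits have finitely many components, so the law of a random set of them is a pmf.\<close>

definition bounded_error_model :: "component set \<Rightarrow> real \<Rightarrow> component set pmf \<Rightarrow> bool" where
  "bounded_error_model K p \<mu> \<longleftrightarrow>
     set_pmf \<mu> \<subseteq> Pow K \<and>
     (\<forall>S\<subseteq>K. measure_pmf.prob \<mu> {F. S \<subseteq> F} \<le> p ^ card S)"

text \<open>
  For a one-bit circuit \<open>C\<close> and failures of its \<open>n\<close>-fold simulation distributed by \<open>\<mu>\<close>. The law \<open>\<nu>\<close>
  is a joint distribution of the failing set \<open>F\<close> (with marginal \<open>\<mu>\<close>) and the random set \<open>E\<close> of
  failing wires of \<open>C\<close>; as \<open>E\<close> contains only wires, the gadgets of \<open>C\<close> act perfectly.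
\<close>

definition experiences_wire_error_model ::
  "circuit \<Rightarrow> circuit \<Rightarrow> nat \<Rightarrow> circuit \<Rightarrow> component set pmf \<Rightarrow> real \<Rightarrow> bool" where
  "experiences_wire_error_model P Q n C \<mu> q \<longleftrightarrow>
     (\<exists>\<nu> :: (component set \<times> component set) pmf.
        map_pmf fst \<nu> = \<mu> \<and>
        bounded_error_model (wires 1 C) q (map_pmf snd \<nu>) \<and>
        (\<forall>(F, E)\<in>set_pmf \<nu>. \<forall>b y.
           possible_output F (FTn P Q n 1 C) (replicate (3 ^ n) b) y \<longrightarrow>
           possible_output E C [b] [decode n y]))"


section \<open>Sanity checks\<close>

lemma Y1_swaps_blocks: "run Y1 [a, b, c, d, e, f] = [d, e, f, a, b, c]"
  by (simp add: run_def Y1_def)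

lemma block_transposer_exists:
  "block_transposer
     [[X0, X0, Y0, X0, Y0, X0, X0],
      [X0, Y0, Y0, X0, Y0, X0],
      [X0, X0, X0, X0, Y0, X0, X0, X0],
      [X0, X0, X0, Y0, Y0, X0, X0],
      [X0, X0, Y0, X0, X0, X0, X0, X0]]"
  (is "block_transposer ?P")
proof -
  have "\<forall>i<3. \<forall>j<3. run ?P xs ! (3 * j + i) = xs ! (3 * i + j)"
    if xs: "length xs = 9" for xs :: "bool list"
  proof -
    obtain a b c d e f g h k where abc: "xs = [a, b, c, d, e, f, g, h, k]"
      using xs by (auto simp: numeral_eq_Suc length_Suc_conv)
    have "run ?P xs = [a, d, g, b, e, h, c, f, k]"
      by (simp add: run_def abc)
    then show ?thesis by (simp add: abc numeral_3_eq_3 All_less_Suc)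
  qed
  then show ?thesis by (simp add: block_transposer_def width_def)
qed

lemma simulate_layer_unmixed:
  assumes P: "block_transposer P" and Q: "block_transposer Q"
    and L: "set L \<subseteq> {X0, Y0} \<or> set L \<subseteq> {Z0}" and L': "L' \<in> set (simulate_layer P Q L)"
  shows "set L' \<subseteq> {X0, Y0} \<or> set L' \<subseteq> {Z0}"
proof -
  obtain s where s: "L' = concat (map (level1_layer P Q s) L)"
    and s_less: "s < Max (insert 0 ((\<lambda>g. length (level1 P Q g)) ` set L))"
    using L' by (auto simp: simulate_layer_def)
  from L show ?thesis
  proof
    assume XY: "set L \<subseteq> {X0, Y0}"
    have "set K \<subseteq> {X0, Y0}" if "K \<in> set X1 \<or> K \<in> set Y1" for K
      using that by (auto simp: X1_def Y1_def)
    then have "set (level1_layer P Q s g) \<subseteq> {X0, Y0}" if "g \<in> {X0, Y0}" for g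
      using that by (auto simp: level1_layer_def subset_iff) (meson nth_mem)+
    with XY show ?thesis by (auto simp: s subset_iff)
  next
    assume Z: "set L \<subseteq> {Z0}"
    with s_less have "s < length (Z1 P Q)"
      by (cases "set L = {}") (auto simp: subset_singleton_iff)
    then have "Z1 P Q ! s \<in> set (Z1 P Q)" by (rule nth_mem)
    then have "set (Z1 P Q ! s) \<subseteq> {X0, Y0} \<or> set (Z1 P Q ! s) \<subseteq> {Z0}"
      using P Q by (auto simp: Z1_def block_transposer_def)
    moreover have "set L' \<subseteq> set (Z1 P Q ! s)"
      using Z \<open>s < length (Z1 P Q)\<close> by (auto simp: s level1_layer_def)
    ultimately show ?thesis by blast
  qed
qed

lemma FTn_layers_unmixed:
  assumes "block_transposer P" "block_transposer Q"
    and "L \<in> set (FTn P Q n 1 (replicate T [X0]))"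
  shows "set L \<subseteq> {X0, Y0} \<or> set L \<subseteq> {Z0}"
  using assms(3)
proof (induction n arbitrary: L)
  case 0
  then show ?case by (auto split: if_splits)
next
  case (Suc n)
  let ?N = "3 ^ n * 1 :: nat" and ?C = "FTn P Q n 1 (replicate T [X0])"
  have "L = replicate ?N Z0 \<or> (\<exists>L'\<in>set ?C. L \<in> set (simulate_layer P Q L'))"
    using Suc.prems by (auto simp: FT_def split: if_splits)
  then show ?case
  proof
    assume "L = replicate ?N Z0"
    then have "set L \<subseteq> {Z0}" by auto
    then show ?thesis by blast
  next
    assume "\<exists>L'\<in>set ?C. L \<in> set (simulate_layer P Q L')"
    then obtain L' where L': "L' \<in> set ?C" and L: "L \<in> set (simulate_layer P Q L')"
      by blast
    show ?thesis
      by (rule simulate_layer_unmixed[OF assms(1,2) Suc.IH[OF L'] L])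
  qed
qed

end

theory Submission
  imports Defs
begin

text \<open>
  The input is constant, all gadgets are monotone and self-dual, so only the set of bits deviating
  from the input matters, and noise can only enlarge it. A level of simulation is undone by
  reading each block, before its correction, by majority: a failing simulated wire then needs one
  failing component, or two if only wires fail. For a swap or an idle this is counting; for a
  majority gadget, few faults spoil at most one output block, while any number of faults is
  explained by flipping input wires until two of them deviate, of which only one flip is needed
  if the inputs already disagree. Thus the first level turns gadget errors of strength \<open>p\<close> into wire
  errors of strength \<open>O(p)\<close>, and each of the remaining \<open>n - 1\<close> levels squares the strength.
  Counting the possible sets of responsible faults costs a constant factor per wire, because these
  faults lie in a neighbourhood of bounded size.
\<close>

section \<open>Bit lists\<close>

text \<open>The obstacle is the majority gadget: with one deviating input, two faults before its
  middle layer can break two inner majorities and thereby all three output blocks. Charging three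
  output flips to two faults would ruin the squaring; a single input flip, at a cost of two, covers
  the same damage. Blocks are read before their correction because a correction layer leaves exact
  codewords up to its own noise, so that a gadget can be treated for an arbitrary incoming state.
  The error model demands a bound for every set of wires, so a simulated error set needs a Hall-type
  condition: each of its subsets has enough faults in its own neighbourhood. At the first level one
  gadget failure can spoil a block, so only one fault per simulated wire is guaranteed, hence the
  exponent \<open>2 ^ (n - 1)\<close>; but the explanation consists of wires alone, so afterwards
  two are guaranteed. With \<open>U = union_factor\<close> the strength becomes \<open>U * p\<close>
  at first and \<open>U * q ^ 2\<close> later, so \<open>U * q\<close> is squared each time; this
  leads to the constant \<open>U * U\<close>.\<close>

abbreviation le_bits :: "bool list \<Rightarrow> bool list \<Rightarrow> bool" (infix "\<preceq>" 50) where
  "xs \<preceq> ys \<equiv> list_all2 (\<longrightarrow>) xs ys"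

definition or_bits :: "bool list \<Rightarrow> bool list \<Rightarrow> bool list" (infixl "\<curlyvee>" 65) where
  "xs \<curlyvee> ys = map2 (\<or>) xs ys"

definition weight :: "bool list \<Rightarrow> nat" where
  "weight xs = length (filter id xs)"

definition rep3 :: "bool list \<Rightarrow> bool list" where
  "rep3 xs = concat (map (replicate 3) xs)"

definition deviation :: "bool \<Rightarrow> bool list \<Rightarrow> bool list" where
  "deviation b xs = map (\<lambda>c. c \<noteq> b) xs"

fun block_maj :: "bool list \<Rightarrow> bool list" where
  "block_maj (a # b # c # xs) = maj a b c # block_maj xs"
| "block_maj _ = []"

lemma weight_simps [simp]:
  "weight [] = 0" "weight (x # xs) = of_bool x + weight xs"
  "weight (xs @ ys) = weight xs + weight ys"
  by (auto simp: weight_def)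

lemma weight_replicate_False [simp]: "weight (replicate n False) = 0"
  by (simp add: weight_def)

lemma length_deviation [simp]: "length (deviation b xs) = length xs"
  by (simp add: deviation_def)

lemma nth_deviation: "i < length xs \<Longrightarrow> deviation b xs ! i \<longleftrightarrow> xs ! i \<noteq> b"
  by (simp add: deviation_def)

lemma weight_le_length: "weight xs \<le> length xs"
  by (simp add: weight_def)

lemma or_bits_simps [simp]:
  "[] \<curlyvee> ys = []" "xs \<curlyvee> [] = []" "(x # xs) \<curlyvee> (y # ys) = (x \<or> y) # (xs \<curlyvee> ys)"
  by (auto simp: or_bits_def)

lemma length_or_bits [simp]: "length (xs \<curlyvee> ys) = min (length xs) (length ys)"
  by (simp add: or_bits_def)

lemma nth_or_bits: "i < length xs \<Longrightarrow> i < length ys \<Longrightarrow> (xs \<curlyvee> ys) ! i \<longleftrightarrow> xs ! i \<or> ys ! i"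
  by (simp add: or_bits_def)

lemma or_bits_append:
  "length xs = length ys \<Longrightarrow> (xs @ xs') \<curlyvee> (ys @ ys') = (xs \<curlyvee> ys) @ (xs' \<curlyvee> ys')"
  by (simp add: or_bits_def)

lemma or_bits_assoc: "(xs \<curlyvee> ys) \<curlyvee> zs = xs \<curlyvee> (ys \<curlyvee> zs)"
  by (rule nth_equalityI) (auto simp: nth_or_bits)

lemma or_bits_False [simp]: "length xs = n \<Longrightarrow> xs \<curlyvee> replicate n False = xs"
  by (rule nth_equalityI) (auto simp: nth_or_bits)

lemma or_bits_mono: "xs \<preceq> xs' \<Longrightarrow> ys \<preceq> ys' \<Longrightarrow> xs \<curlyvee> ys \<preceq> xs' \<curlyvee> ys'"
  by (auto simp: list_all2_conv_all_nth nth_or_bits)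

lemma le_bits_refl [simp]: "xs \<preceq> xs"
  by (simp add: list_all2_conv_all_nth)

lemma le_bits_trans: "xs \<preceq> ys \<Longrightarrow> ys \<preceq> zs \<Longrightarrow> xs \<preceq> zs"
  by (auto simp: list_all2_conv_all_nth)

lemma weight_or_bits: "length xs = length ys \<Longrightarrow> weight (xs \<curlyvee> ys) \<le> weight xs + weight ys"
  by (induction xs ys rule: list_induct2) auto

lemma rep3_simps [simp]: "rep3 [] = []" "rep3 (x # xs) = x # x # x # rep3 xs"
  by (auto simp: rep3_def numeral_3_eq_3)

lemma length_rep3 [simp]: "length (rep3 xs) = 3 * length xs"
  by (induction xs) auto

lemma length_block_maj [simp]: "length (block_maj xs) = length xs div 3"
  by (induction xs rule: block_maj.induct) auto

lemma block_maj_mono: "xs \<preceq> ys \<Longrightarrow> block_maj xs \<preceq> block_maj ys"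
  by (induction xs arbitrary: ys rule: block_maj.induct)
    (fastforce simp: list_all2_Cons1 maj_def)+

lemma length_3_multiple_Suc:
  assumes "length xs = 3 * Suc n"
  obtains a b c ys where "xs = a # b # c # ys" "length ys = 3 * n"
  using assms by (auto simp: numeral_3_eq_3 length_Suc_conv)

lemma block_maj_append:
  "length xs = 3 * n \<Longrightarrow> block_maj (xs @ ys) = block_maj xs @ block_maj ys"
proof (induction n arbitrary: xs)
  case (Suc n)
  obtain a b c zs where "xs = a # b # c # zs" "length zs = 3 * n"
    using Suc.prems by (rule length_3_multiple_Suc)
  with Suc.IH show ?case by auto
qed auto

text \<open>The bits of a codeword block agree, so noise matters only on zero blocks, and there the
  majority sees the noise alone.\<close>

lemma block_maj_rep3_or:
  "length e = 3 * length z \<Longrightarrow> block_maj (rep3 z \<curlyvee> e) = z \<curlyvee> block_maj e"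
proof (induction z arbitrary: e)
  case (Cons x z)
  have "length e = 3 * Suc (length z)" using Cons.prems by simp
  then obtain a b c e' where "e = a # b # c # e'" "length e' = 3 * length z"
    by (rule length_3_multiple_Suc)
  with Cons.IH show ?case by (auto simp: maj_def)
qed auto

text \<open>The source of the squaring: a deviating majority consumes two deviating bits of its own
  block.\<close>

lemma weight_block_maj: "2 * weight (block_maj e) \<le> weight e"
  by (induction e rule: block_maj.induct) (auto simp: maj_def of_bool_def)

lemma nth_block_maj:
  "length xs = 3 * n \<Longrightarrow> i < n \<Longrightarrow>
     block_maj xs ! i = maj (xs ! (3 * i)) (xs ! (3 * i + 1)) (xs ! (3 * i + 2))"
proof (induction n arbitrary: xs i)
  case (Suc n)
  obtain a b c ys where "xs = a # b # c # ys" "length ys = 3 * n"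
    using Suc.prems(1) by (rule length_3_multiple_Suc)
  with Suc show ?case by (cases i) auto
qed auto


section \<open>Layers\<close>

lemma width_simps [simp]:
  "width [] = 0" "width (g # L) = arity g + width L" "width (L @ M) = width L + width M"
  by (auto simp: width_def)

lemma width_replicate [simp]: "width (replicate n g) = n * arity g"
  by (induction n) auto

lemma length_gadget_map [simp]: "length (gadget_map g xs) = length xs"
  by (cases "(g, xs)" rule: gadget_map.cases) auto

lemma length_run_layer [simp]: "length (run_layer L xs) = length xs"
  by (induction L arbitrary: xs) auto

lemma run_layer_append:
  "length xs = width L \<Longrightarrow> run_layer (L @ M) (xs @ ys) = run_layer L xs @ run_layer M ys"
  by (induction L arbitrary: xs) auto

lemma arity_pos [simp]: "0 < arity g"
  by (cases g) auto

lemma arity_cases: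
  assumes "length xs = arity g"
  obtains a where "g = X0" "xs = [a]"
  | a b where "g = Y0" "xs = [a, b]"
  | a b c where "g = Z0" "xs = [a, b, c]"
  using assms by (cases g) (auto simp: numeral_eq_Suc length_Suc_conv)

lemma gadget_map_mono:
  assumes "length xs = arity g" "xs \<preceq> ys"
  shows "gadget_map g xs \<preceq> gadget_map g ys"
proof -
  have "length ys = arity g" using assms list_all2_lengthD by fastforce
  with assms show ?thesis
    by (elim arity_cases[of xs g] arity_cases[of ys g]) (auto simp: maj_def)
qed

text \<open>For \<open>b = True\<close> this is self-duality, for \<open>b = False\<close> it is
  trivial.\<close>

lemma gadget_map_deviation:
  assumes "length xs = arity g"
  shows "gadget_map g (deviation b xs) = deviation b (gadget_map g xs)"
  using assms by (elim arity_cases) (auto simp: maj_def deviation_def)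

text \<open>Swaps and idles only move bits, so data and noise travel independently. This fails for
  \<open>Z0\<close>, whose simulation needs its own analysis.\<close>

lemma gadget_map_or:
  assumes "g \<in> {X0, Y0}" "length xs = arity g" "length ys = arity g"
  shows "gadget_map g (xs \<curlyvee> ys) = gadget_map g xs \<curlyvee> gadget_map g ys"
  using assms(2,3) assms(1) by (elim arity_cases) auto

lemma weight_gadget_map:
  assumes "g \<in> {X0, Y0}" "length xs = arity g"
  shows "weight (gadget_map g xs) = weight xs"
  using assms(2,1) by (elim arity_cases) auto

lemma run_layer_mono:
  "length xs = width L \<Longrightarrow> xs \<preceq> ys \<Longrightarrow> run_layer L xs \<preceq> run_layer L ys"
proof (induction L arbitrary: xs ys)
  case (Cons g L)
  have "gadget_map g (take (arity g) xs) \<preceq> gadget_map g (take (arity g) ys)"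
    using Cons.prems by (intro gadget_map_mono list_all2_takeI) auto
  moreover have "run_layer L (drop (arity g) xs) \<preceq> run_layer L (drop (arity g) ys)"
    using Cons.prems by (intro Cons.IH list_all2_dropI) auto
  ultimately show ?case by (simp add: list_all2_appendI)
qed auto

lemma run_layer_deviation:
  "length xs = width L \<Longrightarrow> run_layer L (deviation b xs) = deviation b (run_layer L xs)"
proof (induction L arbitrary: xs)
  case (Cons g L)
  have "take n (deviation b xs) = deviation b (take n xs)"
    "drop n (deviation b xs) = deviation b (drop n xs)" for n
    by (simp_all add: deviation_def take_map drop_map)
  with Cons show ?case by (simp add: gadget_map_deviation) (simp add: deviation_def)
qed auto

lemma run_layer_or:
  "set L \<subseteq> {X0, Y0} \<Longrightarrow> length xs = width L \<Longrightarrow> length ys = width L \<Longrightarrow>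
     run_layer L (xs \<curlyvee> ys) = run_layer L xs \<curlyvee> run_layer L ys"
proof (induction L arbitrary: xs ys)
  case (Cons g L)
  have "take n (xs \<curlyvee> ys) = take n xs \<curlyvee> take n ys"
    "drop n (xs \<curlyvee> ys) = drop n xs \<curlyvee> drop n ys" for n
    by (simp_all add: or_bits_def take_map drop_map take_zip drop_zip)
  with Cons show ?case by (auto simp: or_bits_append gadget_map_or)
qed auto

lemma weight_run_layer:
  "set L \<subseteq> {X0, Y0} \<Longrightarrow> length xs = width L \<Longrightarrow> weight (run_layer L xs) = weight xs"
proof (induction L arbitrary: xs)
  case (Cons g L)
  have "weight xs = weight (take (arity g) xs) + weight (drop (arity g) xs)"
    by (metis append_take_drop_id weight_simps(3))
  with Cons show ?case by (auto simp: weight_gadget_map)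
qed auto

lemma run_layer_majorities:
  "length xs = 3 * n \<Longrightarrow> run_layer (replicate n Z0) xs = rep3 (block_maj xs)"
proof (induction n arbitrary: xs)
  case (Suc n)
  obtain a b c ys where "xs = a # b # c # ys" "length ys = 3 * n"
    using Suc.prems(1) by (rule length_3_multiple_Suc)
  with Suc.IH show ?case by (auto simp: numeral_3_eq_3)
qed auto

lemma run_simps [simp]: "run [] xs = xs" "run (L # C) xs = run C (run_layer L xs)"
  by (auto simp: run_def)

lemma length_run [simp]: "length (run C xs) = length xs"
  by (induction C arbitrary: xs) auto


section \<open>Worst-case noise\<close>

text \<open>
  Noise is tracked through the set of bits that deviate from the encoded input. All gadgets are
  monotone and self-dual, so the worst that a failing component can do is to make all bits that
  it touches deviate. Unlike in the noise model, \<open>Gadget s j\<close> now denotes the gadget of layer \<open>s\<close>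
  whose first bit is \<open>j\<close> (see \<open>position\<close>). Circuits are placed at time \<open>s\<close> and position \<open>p\<close>.
\<close>

definition wire_noise :: "component set \<Rightarrow> nat \<Rightarrow> nat \<Rightarrow> nat \<Rightarrow> bool list" where
  "wire_noise F s p m = map (\<lambda>j. Wire s j \<in> F) [p..<p + m]"

text \<open>The wires after a layer are attached to it, so consecutive layers draw on disjoint sets
  of components; the input wires at time 0 are left to \<open>noisy_output\<close>.\<close>

fun layer_noise :: "component set \<Rightarrow> nat \<Rightarrow> nat \<Rightarrow> layer \<Rightarrow> bool list" where
  "layer_noise F s p [] = []"
| "layer_noise F s p (g # L) =
     map (\<lambda>j. Gadget s p \<in> F \<or> Wire (Suc s) j \<in> F) [p..<p + arity g] @ layer_noise F s (p + arity g) L"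

definition wires_only :: "component set \<Rightarrow> bool" where
  "wires_only F \<longleftrightarrow> (\<forall>s j. Gadget s j \<notin> F)"

fun noisy_run :: "component set \<Rightarrow> nat \<Rightarrow> nat \<Rightarrow> circuit \<Rightarrow> bool list \<Rightarrow> bool list" where
  "noisy_run F s p [] xs = xs"
| "noisy_run F s p (L # C) xs = noisy_run F (Suc s) p C (run_layer L xs \<curlyvee> layer_noise F s p L)"

fun total_noise :: "component set \<Rightarrow> nat \<Rightarrow> nat \<Rightarrow> circuit \<Rightarrow> nat" where
  "total_noise F s p [] = 0"
| "total_noise F s p (L # C) = weight (layer_noise F s p L) + total_noise F (Suc s) p C"

definition noisy_output :: "component set \<Rightarrow> nat \<Rightarrow> circuit \<Rightarrow> bool list" where
  "noisy_output F N C = noisy_run F 0 0 C (wire_noise F 0 0 N)"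

lemma length_wire_noise [simp]: "length (wire_noise F s p m) = m"
  by (simp add: wire_noise_def)

lemma nth_wire_noise: "i < m \<Longrightarrow> wire_noise F s p m ! i \<longleftrightarrow> Wire s (p + i) \<in> F"
  by (simp add: wire_noise_def)

lemma wire_noise_add: "wire_noise F s p (m + n) = wire_noise F s p m @ wire_noise F s (p + m) n"
  by (rule nth_equalityI) (auto simp: nth_wire_noise nth_append)

lemma wire_noise_mono: "F \<subseteq> G \<Longrightarrow> wire_noise F s p m \<preceq> wire_noise G s p m"
  by (auto simp: list_all2_conv_all_nth nth_wire_noise)

lemma length_layer_noise [simp]: "length (layer_noise F s p L) = width L"
  by (induction L arbitrary: p) auto

lemma layer_noise_append:
  "layer_noise F s p (L @ M) = layer_noise F s p L @ layer_noise F s (p + width L) M"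
  by (induction L arbitrary: p) (auto simp: add.assoc)

lemma layer_noise_wires:
  assumes "wires_only F"
  shows "layer_noise F s p L = wire_noise F (Suc s) p (width L)"
proof (induction L arbitrary: p)
  case (Cons g L)
  have "Gadget s p \<notin> F" using assms by (simp add: wires_only_def)
  with Cons show ?case by (simp add: wire_noise_add) (simp add: wire_noise_def)
qed (simp add: wire_noise_def)

lemma layer_noise_mono: "F \<subseteq> G \<Longrightarrow> layer_noise F s p L \<preceq> layer_noise G s p L"
proof (induction L arbitrary: p)
  case (Cons g L)
  then show ?case
    by (auto intro!: list_all2_appendI) (auto simp: list_all2_conv_all_nth)
qed auto

lemma length_noisy_run [simp]:
  "\<forall>L\<in>set C. width L = length xs \<Longrightarrow> length (noisy_run F s p C xs) = length xs"
  by (induction C arbitrary: s xs) auto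

lemma noisy_run_append:
  "noisy_run F s p (C @ D) xs = noisy_run F (s + length C) p D (noisy_run F s p C xs)"
  by (induction C arbitrary: s xs) auto

lemma total_noise_append:
  "total_noise F s p (C @ D) = total_noise F s p C + total_noise F (s + length C) p D"
  by (induction C arbitrary: s) auto

lemma noisy_run_mono:
  assumes "F \<subseteq> G" "\<forall>L\<in>set C. width L = length xs" "xs \<preceq> ys"
  shows "noisy_run F s p C xs \<preceq> noisy_run G s p C ys"
  using assms(2,3)
proof (induction C arbitrary: s xs ys)
  case (Cons L C)
  have "run_layer L xs \<curlyvee> layer_noise F s p L \<preceq> run_layer L ys \<curlyvee> layer_noise G s p L"
    using Cons.prems by (intro or_bits_mono run_layer_mono layer_noise_mono assms(1)) auto
  with Cons show ?case by auto
qed auto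

lemma noisy_run_parallel:
  assumes "length C = length D" "\<forall>L\<in>set C. width L = length xs" "\<forall>L\<in>set D. width L = length ys"
  shows "noisy_run F s p (map2 (@) C D) (xs @ ys) =
           noisy_run F s p C xs @ noisy_run F s (p + length xs) D ys"
  using assms
proof (induction C D arbitrary: s xs ys rule: list_induct2)
  case (Cons L C M D)
  then show ?case
    by (auto simp: run_layer_append layer_noise_append or_bits_append)
qed auto

text \<open>Swaps carry deviations along without multiplying them, so the final error is no heavier
  than all the noise met on the way, whatever the data.\<close>

lemma noisy_run_swaps:
  assumes "\<forall>L\<in>set C. set L \<subseteq> {X0, Y0} \<and> width L = length xs" "length e = length xs"
  shows "\<exists>e'. length e' = length xs \<and> noisy_run F s p C (xs \<curlyvee> e) = run C xs \<curlyvee> e' \<and>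
           weight e' \<le> weight e + total_noise F s p C"
  using assms
proof (induction C arbitrary: s xs e)
  case (Cons L C)
  define d where "d = run_layer L e \<curlyvee> layer_noise F s p L"
  have "run_layer L (xs \<curlyvee> e) \<curlyvee> layer_noise F s p L = run_layer L xs \<curlyvee> d"
    using Cons.prems by (simp add: d_def run_layer_or or_bits_assoc)
  moreover have "weight d \<le> weight e + weight (layer_noise F s p L)"
    using Cons.prems weight_or_bits[of "run_layer L e" "layer_noise F s p L"]
    by (auto simp: d_def weight_run_layer)
  moreover obtain e' where "length e' = length xs"
    "noisy_run F (Suc s) p C (run_layer L xs \<curlyvee> d) = run C (run_layer L xs) \<curlyvee> e'"
    "weight e' \<le> weight d + total_noise F (Suc s) p C"
    using Cons.IH[of "run_layer L xs" d "Suc s"] Cons.prems by (auto simp: d_def)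
  ultimately show ?case by (intro exI[of _ e']) auto
qed auto


section \<open>Simulation of a single gadget\<close>

text \<open>After transposition each block holds one copy of every encoded bit, so a vote within a
  block is a vote over the three inputs. The same identity, applied to the inner votes, spreads them
  over all output blocks.\<close>

lemma run_block_transposer:
  assumes "block_transposer R"
  shows "run R (rep3 [a, b, c]) = [a, b, c, a, b, c, a, b, c]"
proof (rule nth_equalityI)
  fix k assume "k < length (run R (rep3 [a, b, c]))"
  then have "k < 9" by simp
  define j i where "j = k div 3" and "i = k mod 3"
  have k: "k = 3 * j + i" "i < 3" "j < 3" using \<open>k < 9\<close> by (auto simp: i_def j_def)
  have "run R (rep3 [a, b, c]) ! (3 * j + i) = rep3 [a, b, c] ! (3 * i + j)"
    using assms k by (auto simp: block_transposer_def)
  also have "\<dots> = [a, b, c, a, b, c, a, b, c] ! (3 * j + i)"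
    using k by (auto simp: numeral_3_eq_3 less_Suc_eq)
  finally show "run R (rep3 [a, b, c]) ! k = [a, b, c, a, b, c, a, b, c] ! k"
    by (simp add: k)
qed simp

section \<open>Two rounds of voting in the simulated majority gadget\<close>

lemma length_3_cases:
  assumes "length xs = 3"
  obtains a b c where "xs = [a, b, c]"
  using assms by (auto simp: numeral_3_eq_3 length_Suc_conv)

lemma length_9_cases:
  assumes "length xs = 9"
  obtains a b c d e f g h k where "xs = [a, b, c, d, e, f, g, h, k]"
  using assms by (auto simp: numeral_eq_Suc length_Suc_conv)

text \<open>With at most one deviating copy per block, a wrong majority needs at least one bit of
  noise inside its block.\<close>

lemma weight_transposed_majorities:
  assumes "length e = 9" and w: "weight [a, b, c] \<le> 1"
  shows "weight (block_maj ([a, b, c, a, b, c, a, b, c] \<curlyvee> e)) \<le> weight e"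
proof -
  obtain e1 e2 e3 e4 e5 e6 e7 e8 e9 where e: "e = [e1, e2, e3, e4, e5, e6, e7, e8, e9]"
    using assms(1) by (rule length_9_cases)
  have "of_bool (maj (a \<or> d) (b \<or> f) (c \<or> g)) \<le> (of_bool d + of_bool f + of_bool g :: nat)" for d f g
    using w by (auto simp: maj_def)
  from this[of e1 e2 e3] this[of e4 e5 e6] this[of e7 e8 e9] show ?thesis
    by (simp add: e)
qed

lemma block_maj_zero_or:
  assumes "length e = 9"
  shows "weight [a, b, c] = 0 \<Longrightarrow> [a, b, c, a, b, c, a, b, c] \<curlyvee> e = e"
  using assms by (elim length_9_cases) auto

text \<open>Here \<open>e\<close> and \<open>f\<close> are the errors accumulated before the inner
  and before the output votes. If the noise pays for making two inputs deviate, all outputs may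
  deviate and nothing is left to explain; otherwise the noise is so small that at most one output
  block is wrong, and an output flip covers it.\<close>

lemma transposed_majorities_explained:
  assumes x: "x = [a, b, c]" and e: "length e = 9" "length f = 9"
    and w: "block_maj ([a, b, c, a, b, c, a, b, c] \<curlyvee> e) = [u, v, w]"
    and n: "weight e + weight f \<le> n"
  shows "\<exists>A B. length A = 3 \<and> length B = 3 \<and>
           block_maj ([u, v, w, u, v, w, u, v, w] \<curlyvee> f) \<preceq> gadget_map Z0 (x \<curlyvee> A) \<curlyvee> B \<and>
           weight A + weight B \<le> 2 \<and> 2 * (weight A + weight B) \<le> n"
proof -
  define z where "z = block_maj ([u, v, w, u, v, w, u, v, w] \<curlyvee> f)"
  have len_z: "length z = 3" using e by (simp add: z_def)
  have zero: "z \<preceq> gadget_map Z0 (x \<curlyvee> [False, False, False]) \<curlyvee> [False, False, False]"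
    if "weight z = 0"
    using len_z that by (elim length_3_cases) (auto simp: x)
  have all: ?thesis if "length A = 3" "gadget_map Z0 (x \<curlyvee> A) = [True, True, True]"
    "weight A \<le> 2" "2 * weight A \<le> n" for A
  proof -
    have "z \<preceq> gadget_map Z0 (x \<curlyvee> A) \<curlyvee> [False, False, False]"
      using len_z that(2) by (elim length_3_cases) auto
    with that show ?thesis unfolding z_def
      by (intro exI[of _ A] exI[of _ "[False, False, False]"]) auto
  qed
  have uvw1: "weight [u, v, w] \<le> weight e" if "weight x \<le> 1"
    using weight_transposed_majorities[OF e(1), of a b c] that w by (simp add: x)
  have uvw0: "2 * weight [u, v, w] \<le> weight e" if "weight x = 0"
    using block_maj_zero_or[OF e(1), of a b c] weight_block_maj[of e] that w by (simp add: x)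
  have z1: "weight z \<le> weight f" if "weight [u, v, w] \<le> 1"
    unfolding z_def by (rule weight_transposed_majorities[OF e(2) that])
  have z0: "2 * weight z \<le> weight f" if "weight [u, v, w] = 0"
    unfolding z_def using block_maj_zero_or[OF e(2) that] weight_block_maj[of f] by simp
  consider "n \<ge> 4" | "weight x \<ge> 2" | "weight x = 1" "n \<ge> 2" | "weight x = 1" "n \<le> 1"
    | "weight x = 0" "n \<le> 3"
    by linarith
  then show ?thesis
  proof cases
    \<comment> \<open>Four deviating bits pay for two input flips.\<close>
    case 1
    then show ?thesis by (intro all[of "[True, True, False]"]) (auto simp: x maj_def)
  next
    case 2
    then show ?thesis
      by (intro all[of "[False, False, False]"]) (auto simp: x maj_def of_bool_def split: if_splits)
  next
    case 3
    then show ?thesis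
      \<comment> \<open>One more deviating input suffices; the flip must avoid the input that
        already deviates.\<close>
      by (intro all[of "if a then [False, True, False] else [True, False, False]"])
        (auto simp: x maj_def)
  next
    \<comment> \<open>A single deviating bit, before or after the inner votes, cannot survive both
      rounds of voting.\<close>
    case 4
    have "weight z = 0"
    proof (cases "weight [u, v, w] = 0")
      case True
      then show ?thesis using z0 n 4 by linarith
    next
      case False
      then show ?thesis using z1 uvw1 n 4 by linarith
    qed
    with zero show ?thesis unfolding z_def
      by (intro exI[of _ "[False, False, False]"]) auto
  next
    \<comment> \<open>Breaking an inner vote costs two bits of \<open>e\<close>. At most one breaks,
      and then at most one bit of \<open>f\<close> is left to spoil an output block; if none breaks,
      an output block costs two bits of \<open>f\<close>.\<close>
    case 5
    have "weight z \<le> 1 \<and> 2 * weight z \<le> n"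
    proof (cases "weight [u, v, w] = 0")
      case True
      then show ?thesis using z0 n 5 by linarith
    next
      case False
      then show ?thesis using z1 uvw0 n 5 by linarith
    qed
    moreover have "z \<preceq> gadget_map Z0 (x \<curlyvee> [False, False, False]) \<curlyvee> z"
      using len_z by (elim length_3_cases) (auto simp: x)
    ultimately show ?thesis using len_z unfolding z_def[symmetric]
      by (intro exI[of _ "[False, False, False]"] exI[of _ z]) auto
  qed
qed

lemma level1_swaps:
  assumes "g \<in> {X0, Y0}"
  shows "\<forall>L\<in>set (level1 P Q g). set L \<subseteq> {X0, Y0} \<and> width L = 3 * arity g"
    and "length x = arity g \<Longrightarrow> run (level1 P Q g) (rep3 x) = rep3 (gadget_map g x)"
proof -
  show "\<forall>L\<in>set (level1 P Q g). set L \<subseteq> {X0, Y0} \<and> width L = 3 * arity g"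
    using assms by (auto simp: X1_def Y1_def)
  assume "length x = arity g"
  then show "run (level1 P Q g) (rep3 x) = rep3 (gadget_map g x)"
    using assms by (elim arity_cases) (auto simp: X1_def Y1_def Y1_swaps_blocks[unfolded Y1_def])
qed

text \<open>A correction is grouped with the gadget that follows it, which then starts from a
  codeword up to the noise of that correction. The last correction layer is treated apart in
  \<open>output_charged\<close>.\<close>

definition corrected_level1 :: "circuit \<Rightarrow> circuit \<Rightarrow> gadget \<Rightarrow> circuit" where
  "corrected_level1 P Q g = replicate (arity g) Z0 # level1 P Q g"

text \<open>
  \<open>A\<close> and \<open>B\<close> are the flips on the input and output wires of the simulated gadget by which the
  noise is explained: one flip for every two deviating bits.
\<close>

lemma noisy_level1_explained:
  assumes P: "block_transposer P" and Q: "block_transposer Q" and y: "length y = 3 * arity g"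
  shows "\<exists>A B. length A = arity g \<and> length B = arity g \<and>
           block_maj (noisy_run F s p (corrected_level1 P Q g) y)
             \<preceq> gadget_map g (block_maj y \<curlyvee> A) \<curlyvee> B \<and>
           weight A + weight B \<le> 2 \<and>
           2 * (weight A + weight B) \<le> total_noise F s p (corrected_level1 P Q g)"
proof (cases "g = Z0")
  case False
  then have g: "g \<in> {X0, Y0}" by (cases g) auto
  let ?C = "level1 P Q g" and ?x = "block_maj y" and ?e = "layer_noise F s p (replicate (arity g) Z0)"
  have x: "length ?x = arity g" using y by simp
  obtain e where e: "length e = 3 * arity g"
    "noisy_run F (Suc s) p ?C (rep3 ?x \<curlyvee> ?e) = run ?C (rep3 ?x) \<curlyvee> e"
    "weight e \<le> weight ?e + total_noise F (Suc s) p ?C"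
    using noisy_run_swaps[of ?C "rep3 ?x" ?e F "Suc s" p] level1_swaps(1)[OF g] x by auto
  have "block_maj (noisy_run F s p (corrected_level1 P Q g) y) = gadget_map g ?x \<curlyvee> block_maj e"
    using e(1,2) x y
    by (simp add: corrected_level1_def run_layer_majorities[of y "arity g"] level1_swaps(2)[OF g x]
        block_maj_rep3_or)
  moreover have "length (block_maj e) = arity g" using e(1) by simp
  moreover have "arity g \<le> 2" using g by auto
  ultimately show ?thesis
    using e(3) weight_block_maj[of e] weight_le_length[of "block_maj e"] x
    by (intro exI[of _ "replicate (arity g) False"] exI[of _ "block_maj e"])
      (auto simp: corrected_level1_def)
next
  case True
  define M where "M = replicate 3 Z0"
  define d1 where "d1 = layer_noise F s p M"
  \<comment> \<open>The correction runs at time \<open>s\<close>, \<open>P\<close> from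
    \<open>s + 1\<close> to \<open>s + 5\<close>, the inner majorities at \<open>s + 6\<close>, and
    \<open>Q\<close> from \<open>s + 7\<close>.\<close>
  define d2 where "d2 = layer_noise F (6 + s) p M"
  have d: "length d1 = 9" "length d2 = 9" by (simp_all add: d1_def d2_def M_def)
  have M: "run_layer M xs = rep3 (block_maj xs)" if "length xs = 9" for xs
    using run_layer_majorities[of xs 3] that by (simp add: M_def)
  have C: "corrected_level1 P Q g = M # P @ M # Q"
    by (simp add: True corrected_level1_def Z1_def M_def numeral_3_eq_3)
  have y9: "length y = 9" using y True by simp
  obtain a b c where x: "block_maj y = [a, b, c]"
    using y9 by (auto intro: length_3_cases[of "block_maj y"])
  have swaps: "\<forall>L\<in>set R. set L \<subseteq> {X0, Y0} \<and> width L = 9"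
    if "block_transposer R" for R
    using that by (auto simp: block_transposer_def)
  have len: "length P = 5" using P by (simp add: block_transposer_def)
  have "\<exists>e. length e = length (rep3 z) \<and>
      noisy_run F t p R (rep3 z \<curlyvee> d) = run R (rep3 z) \<curlyvee> e \<and> weight e \<le> weight d + total_noise F t p R"
    if "block_transposer R" "length z = 3" "length d = 9" for R t z d
    using swaps[OF that(1)] that(2,3) by (intro noisy_run_swaps) auto
  note noise = this[unfolded length_rep3]
  obtain e where e: "length e = 9"
    "noisy_run F (Suc s) p P (rep3 [a, b, c] \<curlyvee> d1) = [a, b, c, a, b, c, a, b, c] \<curlyvee> e"
    "weight e \<le> weight d1 + total_noise F (Suc s) p P"
    using noise[OF P _ d(1), of "[a, b, c]" "Suc s"] run_block_transposer[OF P, of a b c] by auto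
  define W where "W = block_maj ([a, b, c, a, b, c, a, b, c] \<curlyvee> e)"
  have "length W = 3" using e(1) by (simp add: W_def)
  then obtain u v w where w: "W = [u, v, w]" by (rule length_3_cases)
  obtain f where f: "length f = 9"
    "noisy_run F (7 + s) p Q (rep3 [u, v, w] \<curlyvee> d2) = [u, v, w, u, v, w, u, v, w] \<curlyvee> f"
    "weight f \<le> weight d2 + total_noise F (7 + s) p Q"
    using noise[OF Q _ d(2), of "[u, v, w]" "7 + s"] run_block_transposer[OF Q, of u v w] by auto
  have "run_layer M y = rep3 [a, b, c]" by (simp only: M[OF y9] x)
  moreover have "run_layer M ([a, b, c, a, b, c, a, b, c] \<curlyvee> e) = rep3 [u, v, w]"
    using e(1) by (subst M) (simp_all add: w[symmetric] W_def)
  ultimately have "noisy_run F s p (corrected_level1 P Q g) y =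
      [u, v, w, u, v, w, u, v, w] \<curlyvee> f"
    using e(2) f(2) len
    by (simp add: C noisy_run_append d1_def[symmetric] d2_def[symmetric] del: rep3_simps)
  moreover have "weight e + weight f \<le> total_noise F s p (corrected_level1 P Q g)"
    using e(3) f(3) len by (simp add: C total_noise_append d1_def d2_def)
  ultimately show ?thesis
    using transposed_majorities_explained[OF x e(1) f(1) w[unfolded W_def]] True by simp
qed


section \<open>Charging simulated failures to faults\<close>

text \<open>Indexed like \<open>layer_noise\<close>, with the wires after a layer belonging to it,
  so that adjacent regions are disjoint and fault counts add up.\<close>

definition region :: "nat \<Rightarrow> nat \<Rightarrow> nat \<Rightarrow> nat \<Rightarrow> component set" where
  "region s n p m =
     {c. \<exists>r j. s \<le> r \<and> r < s + n \<and> p \<le> j \<and> j < p + m \<and> (c = Gadget r j \<or> c = Wire (Suc r) j)}"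

lemma region_Suc: "region s (Suc n) p m = region s 1 p m \<union> region (Suc s) n p m"
proof -
  have "s \<le> r \<and> r < s + Suc n \<longleftrightarrow> s \<le> r \<and> r < s + 1 \<or> Suc s \<le> r \<and> r < Suc s + n" for r
    by auto
  then show ?thesis unfolding region_def by blast
qed

lemma region_add: "region s n p (m + m') = region s n p m \<union> region s n (p + m) m'"
proof -
  have "p \<le> j \<and> j < p + (m + m') \<longleftrightarrow> p \<le> j \<and> j < p + m \<or> p + m \<le> j \<and> j < p + m + m'" for j
    by auto
  then show ?thesis unfolding region_def by blast
qed

lemma card_Int_Un_disjoint:
  assumes "finite F" "R \<inter> R' = {}"
  shows "card (F \<inter> (R \<union> R')) = card (F \<inter> R) + card (F \<inter> R')"
  unfolding Int_Un_distrib using assms by (intro card_Un_disjoint) auto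

lemma card_wires: "length xs = m \<Longrightarrow> card {Wire s (p + i) | i. i < m \<and> xs ! i} = weight xs"
proof -
  assume m: "length xs = m"
  have "{Wire s (p + i) | i. i < m \<and> xs ! i} = (\<lambda>i. Wire s (p + i)) ` {i. i < length xs \<and> id (xs ! i)}"
    using m by auto
  then show ?thesis
    by (simp add: weight_def length_filter_conv_card card_image inj_on_def)
qed

text \<open>A failing gadget spoils up to three bits, a failing wire only one.\<close>

lemma weight_layer_noise:
  assumes F: "finite F" and k: "k = 3 \<or> k = 1 \<and> wires_only F"
  shows "weight (layer_noise F s p L) \<le> k * card (F \<inter> region s 1 p (width L))"
proof (induction L arbitrary: p)
  case (Cons g L)
  let ?R = "region s 1 p (arity g)" and ?R' = "region s 1 (p + arity g) (width L)"
  let ?e = "map (\<lambda>j. Gadget s p \<in> F \<or> Wire (Suc s) j \<in> F) [p..<p + arity g]"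
  have "weight ?e \<le> k * card (F \<inter> ?R)"
  proof (cases "Gadget s p \<in> F")
    case True
    then have "Gadget s p \<in> F \<inter> ?R" by (auto simp: region_def)
    then have "0 < card (F \<inter> ?R)" using F by (metis card_gt_0_iff empty_iff finite_Int)
    moreover have "k = 3" using k True by (auto simp: wires_only_def)
    moreover have "weight ?e \<le> 3" using weight_le_length[of ?e] by (cases g) auto
    ultimately show ?thesis by simp
  next
    case False
    have "weight ?e = card {Wire (Suc s) (p + i) | i. i < arity g \<and> ?e ! i}"
      by (rule card_wires[symmetric]) simp
    also have "\<dots> \<le> card (F \<inter> ?R)"
      using F False by (intro card_mono) (auto simp: region_def)
    also have "\<dots> \<le> k * card (F \<inter> ?R)" using k by auto
    finally show ?thesis .
  qed
  moreover have "card (F \<inter> region s 1 p (width (g # L))) = card (F \<inter> ?R) + card (F \<inter> ?R')"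
    unfolding width_simps region_add by (rule card_Int_Un_disjoint[OF F]) (auto simp: region_def)
  ultimately show ?case using Cons[of "p + arity g"] by (simp add: distrib_left)
qed simp

lemma total_noise_le:
  assumes F: "finite F" and k: "k = 3 \<or> k = 1 \<and> wires_only F"
    and "\<forall>L\<in>set C. width L = m"
  shows "total_noise F s p C \<le> k * card (F \<inter> region s (length C) p m)"
  using assms(3)
proof (induction C arbitrary: s)
  case (Cons L C)
  have "card (F \<inter> region s (length (L # C)) p m) =
      card (F \<inter> region s 1 p m) + card (F \<inter> region (Suc s) (length C) p m)"
    by (simp only: list.size add_Suc_right add_0_right region_Suc)
      (rule card_Int_Un_disjoint[OF F], auto simp: region_def)
  with Cons weight_layer_noise[OF F k, of s p L] show ?case
    by (simp add: distrib_left add_mono)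
qed simp

text \<open>
  \<open>T t\<close> is the layer of the simulating circuit in which the bits between the layers \<open>t - 1\<close> and \<open>t\<close>
  of the simulated circuit are corrected, and \<open>near T w\<close> contains all components whose failure
  may be the cause of a failure of the simulated wire \<open>w\<close>.
\<close>

fun near :: "(nat \<Rightarrow> nat) \<Rightarrow> component \<Rightarrow> component set" where
  "near T (Wire t i) =
     (\<Union>s\<in>{T (t - 1)..T (Suc t)}. \<Union>j\<in>{3 * i - 6..<3 * i + 9}. {Wire s j, Gadget s j})"
| "near T (Gadget t k) = {}"

text \<open>The restriction to \<open>R\<close> keeps the faults used by different parts of the
  circuit apart, so that charges can be added when the parts are put together.\<close>

definition charged :: "(nat \<Rightarrow> nat) \<Rightarrow> nat \<Rightarrow> component set \<Rightarrow> component set \<Rightarrow> component set \<Rightarrow> bool" where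
  "charged T c F E R \<longleftrightarrow> (\<forall>W\<subseteq>E. c * card W \<le> card (F \<inter> R \<inter> (\<Union>w\<in>W. near T w)))"

lemma charged_mono:
  "charged T c F E R \<Longrightarrow> finite F \<Longrightarrow> R \<subseteq> R' \<Longrightarrow> charged T c F E R'"
  unfolding charged_def by (meson Int_mono card_mono finite_Int order.trans order_refl)

text \<open>Only the fault regions are kept disjoint: \<open>E\<close> and \<open>E'\<close> may
  share wires, since output wires of one layer are input wires of the next.\<close>

lemma charged_Un:
  assumes E: "charged T c F E R" and E': "charged T c F E' R'" and "R \<inter> R' = {}" "finite F"
  shows "charged T c F (E \<union> E') (R \<union> R')"
  unfolding charged_def
proof (intro allI impI)
  fix W assume "W \<subseteq> E \<union> E'"
  then have W: "W = (W \<inter> E) \<union> (W \<inter> E')" by blast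
  let ?N = "\<Union>w\<in>W. near T w"
  have *: "c * card V \<le> card (F \<inter> S \<inter> ?N)" if "charged T c F D S" "V \<subseteq> D" "V \<subseteq> W" for V D S
  proof -
    have "c * card V \<le> card (F \<inter> S \<inter> (\<Union>w\<in>V. near T w))"
      using that by (simp add: charged_def)
    also have "\<dots> \<le> card (F \<inter> S \<inter> ?N)"
      using that \<open>finite F\<close> by (intro card_mono) auto
    finally show ?thesis .
  qed
  have "c * card W \<le> c * card (W \<inter> E) + c * card (W \<inter> E')"
    by (metis W card_Un_le distrib_left mult_le_mono2)
  also have "\<dots> \<le> card (F \<inter> R \<inter> ?N) + card (F \<inter> R' \<inter> ?N)"
    using *[OF E, of "W \<inter> E"] *[OF E', of "W \<inter> E'"] by simp
  also have "\<dots> = card (F \<inter> (R \<union> R') \<inter> ?N)"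
    unfolding Int_Un_distrib Int_Un_distrib2 using assms(3,4)
    by (intro card_Un_disjoint[symmetric]) auto
  finally show "c * card W \<le> card (F \<inter> (R \<union> R') \<inter> ?N)" .
qed

lemma charged_UN:
  assumes "finite I" "\<And>i. i \<in> I \<Longrightarrow> charged T c F (E i) (R i)" "disjoint_family_on R I" "finite F"
  shows "charged T c F (\<Union>i\<in>I. E i) (\<Union>i\<in>I. R i)"
  using assms
proof (induction I)
  case empty
  then show ?case by (simp add: charged_def)
next
  case (insert i I)
  have "charged T c F (E i \<union> (\<Union>i\<in>I. E i)) (R i \<union> (\<Union>i\<in>I. R i))"
    using insert by (intro charged_Un insert.IH) (auto simp: disjoint_family_on_def)
  then show ?case by simp
qed

text \<open>If every wire of \<open>E\<close> is near all faults in \<open>R\<close>, each nonempty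
  subset of \<open>E\<close> sees all of them, and the count for \<open>E\<close> itself
  suffices.\<close>

lemma charged_local:
  assumes "finite F" "finite E" "c * card E \<le> card (F \<inter> R)" "\<And>w. w \<in> E \<Longrightarrow> F \<inter> R \<subseteq> near T w"
  shows "charged T c F E R"
  unfolding charged_def
proof (intro allI impI)
  fix W assume W: "W \<subseteq> E"
  show "c * card W \<le> card (F \<inter> R \<inter> (\<Union>w\<in>W. near T w))"
  proof (cases "W = {}")
    case False
    then have "F \<inter> R \<inter> (\<Union>w\<in>W. near T w) = F \<inter> R" using W assms(4) by blast
    moreover have "c * card W \<le> c * card E" using W assms(2) by (intro mult_le_mono2 card_mono)
    ultimately show ?thesis using assms(3) by (metis order.trans)
  qed simp
qed

definition charge_rate :: "component set \<Rightarrow> nat \<Rightarrow> bool" where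
  "charge_rate F c \<longleftrightarrow> c = 1 \<or> c = 2 \<and> wires_only F"

text \<open>If gadgets may fail, \<open>2 * n\<close> deviating bits guarantee only
  \<open>2 * n / 3\<close> faults, rounded up; this reaches \<open>n\<close> because
  \<open>n \<le> 2\<close>. If only wires fail, every deviating bit stands for its own
  fault.\<close>

lemma charge_rate_le:
  assumes F: "finite F" "charge_rate F c" and C: "\<forall>L\<in>set C. width L = m"
    and n: "2 * n \<le> total_noise F s p C" "n \<le> 2"
  shows "c * n \<le> card (F \<inter> region s (length C) p m)"
proof (cases "c = 1")
  case True
  then show ?thesis using total_noise_le[OF F(1) _ C, of 3 s p] n by auto
next
  case False
  then have "c = 2" "wires_only F" using F(2) by (auto simp: charge_rate_def)
  then show ?thesis using total_noise_le[OF F(1) _ C, of 1 s p] n by auto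
qed


section \<open>Simulation of a layer\<close>

text \<open>The duration \<open>l\<close> is a parameter, not a maximum over \<open>L\<close>, so
  that it stays fixed in a recursion over \<open>L\<close> down to the empty list.\<close>

definition corrected_layer :: "circuit \<Rightarrow> circuit \<Rightarrow> nat \<Rightarrow> layer \<Rightarrow> circuit" where
  "corrected_layer P Q l L =
     replicate (width L) Z0 # map (\<lambda>s. concat (map (level1_layer P Q s) L)) [0..<l]"

lemma length_corrected_layer [simp]: "length (corrected_layer P Q l L) = Suc l"
  by (simp add: corrected_layer_def)

lemma corrected_layer_Cons:
  assumes "length (level1 P Q g) = l"
  shows "corrected_layer P Q l (g # L) = map2 (@) (corrected_level1 P Q g) (corrected_layer P Q l L)"
  using assms
  by (intro nth_equalityI)
    (auto simp: corrected_layer_def corrected_level1_def nth_Cons level1_layer_def replicate_add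
      split: nat.splits)

lemma width_level1:
  assumes "block_transposer P" "block_transposer Q"
  shows "\<forall>L\<in>set (level1 P Q g). width L = 3 * arity g"
  using assms by (cases g) (auto simp: X1_def Y1_def Z1_def block_transposer_def)

lemma width_corrected_level1:
  assumes "block_transposer P" "block_transposer Q"
  shows "\<forall>L\<in>set (corrected_level1 P Q g). width L = 3 * arity g"
  using width_level1[OF assms, of g] by (auto simp: corrected_level1_def)

lemma width_level1_layer:
  assumes "block_transposer P" "block_transposer Q"
  shows "width (level1_layer P Q s g) = 3 * arity g"
  using width_level1[OF assms, of g] by (auto simp: level1_layer_def)

lemma width_corrected_layer:
  assumes "block_transposer P" "block_transposer Q"
  shows "\<forall>M\<in>set (corrected_layer P Q l L). width M = 3 * width L"
proof -
  have "width (concat (map (level1_layer P Q s) L)) = 3 * width L" for s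
    by (induction L) (auto simp: width_level1_layer[OF assms])
  then show ?thesis by (auto simp: corrected_layer_def)
qed

definition wire_block :: "nat \<Rightarrow> nat \<Rightarrow> nat \<Rightarrow> component set" where
  "wire_block t p m = {Wire r (p + i) | r i. (r = t \<or> r = Suc t) \<and> i < m}"

lemma wire_block_add: "wire_block t p (m + n) = wire_block t p m \<union> wire_block t (p + m) n"
proof (intro equalityI subsetI)
  fix w assume "w \<in> wire_block t p (m + n)"
  then obtain r i where w: "w = Wire r (p + i)" "r = t \<or> r = Suc t" "i < m + n"
    by (auto simp: wire_block_def)
  show "w \<in> wire_block t p m \<union> wire_block t (p + m) n"
  proof (cases "i < m")
    case False
    then have "w = Wire r (p + m + (i - m))" "i - m < n" using w by auto
    with w(2) show ?thesis unfolding wire_block_def by blast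
  qed (use w in \<open>auto simp: wire_block_def\<close>)
qed (auto simp: wire_block_def add.assoc)

lemma corrected_level1_charged:
  assumes P: "block_transposer P" and Q: "block_transposer Q"
    and F: "finite F" "charge_rate F c" and y: "length y = 3 * arity g"
    and T: "mono T" "T (Suc t) = Suc (T t + length (level1 P Q g))"
  shows "\<exists>E\<subseteq>wire_block t p (arity g).
           block_maj (noisy_run F (T t) (3 * p) (corrected_level1 P Q g) y)
             \<preceq> gadget_map g (block_maj y \<curlyvee> wire_noise E t p (arity g)) \<curlyvee> wire_noise E (Suc t) p (arity g) \<and>
           charged T c F E (region (T t) (length (corrected_level1 P Q g)) (3 * p) (3 * arity g))"
proof -
  let ?C = "corrected_level1 P Q g" and ?a = "arity g"
  let ?R = "region (T t) (length ?C) (3 * p) (3 * ?a)"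
  obtain A B where AB: "length A = ?a" "length B = ?a"
    "block_maj (noisy_run F (T t) (3 * p) ?C y) \<preceq> gadget_map g (block_maj y \<curlyvee> A) \<curlyvee> B"
    "weight A + weight B \<le> 2" "2 * (weight A + weight B) \<le> total_noise F (T t) (3 * p) ?C"
    using noisy_level1_explained[OF P Q y] by blast
  define EA EB where "EA = {Wire t (p + i) | i. i < ?a \<and> A ! i}"
    and "EB = {Wire (Suc t) (p + i) | i. i < ?a \<and> B ! i}"
  define E where "E = EA \<union> EB"
  have fin: "finite EA" "finite EB" by (simp_all add: EA_def EB_def)
  have "wire_noise E t p ?a = A" "wire_noise E (Suc t) p ?a = B"
    using AB(1,2) by (auto intro!: nth_equalityI simp: nth_wire_noise E_def EA_def EB_def)
  moreover have "E \<subseteq> wire_block t p ?a"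
    by (auto simp: E_def EA_def EB_def wire_block_def)
  moreover have "charged T c F E ?R"
  proof (rule charged_local)
    have "card E = weight A + weight B"
      using AB(1,2) fin unfolding E_def
      by (subst card_Un_disjoint) (auto simp: EA_def EB_def card_wires)
    then show "c * card E \<le> card (F \<inter> ?R)"
      using charge_rate_le[OF F width_corrected_level1[OF P Q] AB(5,4)] by simp
    have a: "?a \<le> 3" by (cases g) auto
    have T': "T (t - 1) \<le> T t" "T t \<le> T (Suc t)" "T (Suc t) \<le> T (Suc (Suc t))"
      using T(1) by (auto simp: mono_def)
    have R: "?R \<subseteq> (\<Union>s\<in>{T t..T (Suc t)}. \<Union>j\<in>{3 * p..<3 * p + 3 * ?a}. {Wire s j, Gadget s j})"
      using T(2) by (fastforce simp: region_def corrected_level1_def)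
    fix w assume "w \<in> E"
    then obtain r i where w: "w = Wire r (p + i)" "r = t \<or> r = Suc t" "i < ?a"
      by (auto simp: E_def EA_def EB_def)
    \<comment> \<open>A wire may be charged as an input (\<open>r = t\<close>) or as an output
      (\<open>r = Suc t\<close>) of a gadget, so \<open>near\<close> extends over the simulated
      layers before and after it. A gadget of width at most 3 reaches two bits to either side of
      \<open>p + i\<close>, that is two blocks; hence the offsets 6 and 9.\<close>
    have "{T t..T (Suc t)} \<subseteq> {T (r - 1)..T (Suc r)}" using w(2) T' by auto
    moreover have "{3 * p..<3 * p + 3 * ?a} \<subseteq> {3 * (p + i) - 6..<3 * (p + i) + 9}" using w(3) a by auto
    ultimately show "F \<inter> ?R \<subseteq> near T w" using R w(1) by fastforce
  qed (use F fin in \<open>simp_all add: E_def\<close>)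
  ultimately show ?thesis using AB(3) by (intro exI[of _ E]) auto
qed

lemma corrected_layer_charged:
  assumes P: "block_transposer P" and Q: "block_transposer Q"
    and F: "finite F" "charge_rate F c" and y: "length y = 3 * width L"
    and T: "mono T" "T (Suc t) = Suc (T t + l)" and l: "\<forall>g\<in>set L. length (level1 P Q g) = l"
  shows "\<exists>E\<subseteq>wire_block t p (width L).
           block_maj (noisy_run F (T t) (3 * p) (corrected_layer P Q l L) y)
             \<preceq> run_layer L (block_maj y \<curlyvee> wire_noise E t p (width L)) \<curlyvee> wire_noise E (Suc t) p (width L) \<and>
           charged T c F E (region (T t) (Suc l) (3 * p) (3 * width L))"
  using y l
proof (induction L arbitrary: p y)
  case Nil
  have "noisy_run F (T t) (3 * p) (corrected_layer P Q l []) [] = []"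
    by (metis length_0_conv length_noisy_run list.size(3) mult_0_right width_corrected_layer[OF P Q] width_simps(1))
  with Nil show ?case by (intro exI[of _ "{}"]) (auto simp: charged_def wire_noise_def)
next
  case (Cons g L)
  define y1 y2 where "y1 = take (3 * arity g) y" and "y2 = drop (3 * arity g) y"
  have y: "y = y1 @ y2" "length y1 = 3 * arity g" "length y2 = 3 * width L"
    using Cons.prems(1) by (auto simp: y1_def y2_def)
  have lg: "length (level1 P Q g) = l" and lL: "\<forall>h\<in>set L. length (level1 P Q h) = l"
    using Cons.prems(2) by simp_all
  let ?C = "corrected_level1 P Q g" and ?D = "corrected_layer P Q l L"
  let ?R = "region (T t) (Suc l) (3 * p) (3 * arity g)"
  let ?R' = "region (T t) (Suc l) (3 * (p + arity g)) (3 * width L)"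
  have lC: "length ?C = Suc l" using lg by (simp add: corrected_level1_def)
  obtain E1 where E1: "E1 \<subseteq> wire_block t p (arity g)" "charged T c F E1 ?R"
    "block_maj (noisy_run F (T t) (3 * p) ?C y1)
       \<preceq> gadget_map g (block_maj y1 \<curlyvee> wire_noise E1 t p (arity g)) \<curlyvee> wire_noise E1 (Suc t) p (arity g)"
    using corrected_level1_charged[OF P Q F y(2) T(1), of t p, unfolded lg lC, OF T(2)] by blast
  obtain E2 where E2: "E2 \<subseteq> wire_block t (p + arity g) (width L)" "charged T c F E2 ?R'"
    "block_maj (noisy_run F (T t) (3 * (p + arity g)) ?D y2)
       \<preceq> run_layer L (block_maj y2 \<curlyvee> wire_noise E2 t (p + arity g) (width L))
            \<curlyvee> wire_noise E2 (Suc t) (p + arity g) (width L)"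
    using Cons.IH[OF y(3) lL, of "p + arity g"] by blast
  define E where "E = E1 \<union> E2"
  have "noisy_run F (T t) (3 * p) (corrected_layer P Q l (g # L)) y =
      noisy_run F (T t) (3 * p) ?C y1 @ noisy_run F (T t) (3 * (p + arity g)) ?D y2"
    unfolding corrected_layer_Cons[OF lg] y(1) distrib_left y(2)[symmetric]
    by (rule noisy_run_parallel)
      (use lC y width_corrected_level1[OF P Q] width_corrected_layer[OF P Q] in auto)
  then have "block_maj (noisy_run F (T t) (3 * p) (corrected_layer P Q l (g # L)) y) =
      block_maj (noisy_run F (T t) (3 * p) ?C y1) @ block_maj (noisy_run F (T t) (3 * (p + arity g)) ?D y2)"
    using y(2) width_corrected_level1[OF P Q, of g] by (simp add: block_maj_append[of _ "arity g"])
  also have "\<dots> \<preceq> (gadget_map g (block_maj y1 \<curlyvee> wire_noise E t p (arity g)) \<curlyvee> wire_noise E (Suc t) p (arity g)) @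
      (run_layer L (block_maj y2 \<curlyvee> wire_noise E t (p + arity g) (width L))
        \<curlyvee> wire_noise E (Suc t) (p + arity g) (width L))"
  proof (rule list_all2_appendI)
    have sub: "E1 \<subseteq> E" "E2 \<subseteq> E" by (simp_all add: E_def)
    show "block_maj (noisy_run F (T t) (3 * p) ?C y1) \<preceq>
        gadget_map g (block_maj y1 \<curlyvee> wire_noise E t p (arity g)) \<curlyvee> wire_noise E (Suc t) p (arity g)"
      by (rule le_bits_trans[OF E1(3)], intro or_bits_mono gadget_map_mono wire_noise_mono sub le_bits_refl)
        (simp add: y(2))
    show "block_maj (noisy_run F (T t) (3 * (p + arity g)) ?D y2) \<preceq>
        run_layer L (block_maj y2 \<curlyvee> wire_noise E t (p + arity g) (width L))
          \<curlyvee> wire_noise E (Suc t) (p + arity g) (width L)"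
      by (rule le_bits_trans[OF E2(3)], intro or_bits_mono run_layer_mono wire_noise_mono sub le_bits_refl)
        (simp add: y(3))
  qed
  also have "\<dots> = run_layer (g # L) (block_maj y \<curlyvee> wire_noise E t p (width (g # L)))
      \<curlyvee> wire_noise E (Suc t) p (width (g # L))"
    using y by (simp add: block_maj_append[of _ "arity g"] wire_noise_add or_bits_append)
  finally have "block_maj (noisy_run F (T t) (3 * p) (corrected_layer P Q l (g # L)) y) \<preceq>
      run_layer (g # L) (block_maj y \<curlyvee> wire_noise E t p (width (g # L)))
        \<curlyvee> wire_noise E (Suc t) p (width (g # L))" .
  moreover have "E \<subseteq> wire_block t p (width (g # L))"
    using E1(1) E2(1) by (auto simp: E_def wire_block_add)
  moreover have "charged T c F E (region (T t) (Suc l) (3 * p) (3 * width (g # L)))"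
  proof -
    have "charged T c F E (?R \<union> ?R')"
      unfolding E_def by (rule charged_Un[OF E1(2) E2(2)]) (use F(1) in \<open>auto simp: region_def\<close>)
    then show ?thesis
      by (simp add: region_add distrib_left)
  qed
  ultimately show ?case by blast
qed


section \<open>Simulation of a circuit\<close>

definition unmixed :: "nat \<Rightarrow> circuit \<Rightarrow> bool" where
  "unmixed N C \<longleftrightarrow> (\<forall>L\<in>set C. width L = N \<and> (set L \<subseteq> {X0, Y0} \<or> set L \<subseteq> {Z0}))"

text \<open>In an unmixed layer all level-1 gadgets last equally long, 5 or 11 layers, so no padding
  occurs.\<close>

lemma simulate_layer_corrected:
  assumes P: "block_transposer P" and Q: "block_transposer Q"
    and L: "set L \<subseteq> {X0, Y0} \<or> set L \<subseteq> {Z0}" "L \<noteq> []"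
  defines "l \<equiv> length (simulate_layer P Q L)"
  shows "replicate (width L) Z0 # simulate_layer P Q L = corrected_layer P Q l L"
    and "\<forall>g\<in>set L. length (level1 P Q g) = l" and "l \<le> 11"
proof -
  show "replicate (width L) Z0 # simulate_layer P Q L = corrected_layer P Q l L"
    by (simp add: l_def simulate_layer_def corrected_layer_def)
  define k where "k = length (level1 P Q (hd L))"
  have len: "length (level1 P Q g) = (if g = Z0 then 11 else 5)" for g
    using P Q by (cases g) (simp_all add: X1_def Y1_def Z1_def block_transposer_def)
  have "hd L \<in> set L" using L(2) by simp
  with L(1) have k: "length (level1 P Q g) = k" if "g \<in> set L" for g
    using that by (auto simp: k_def len)
  then have "(\<lambda>g. length (level1 P Q g)) ` set L = {k}"
    using \<open>hd L \<in> set L\<close> by force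
  then have "l = k" by (simp add: l_def simulate_layer_def)
  with k show "\<forall>g\<in>set L. length (level1 P Q g) = l" by simp
  have "k \<le> 11" by (simp add: k_def len)
  with \<open>l = k\<close> show "l \<le> 11" by simp
qed

definition later :: "nat \<Rightarrow> component set" where
  "later s = {c. \<exists>r j. s \<le> r \<and> (c = Gadget r j \<or> c = Wire (Suc r) j)}"

lemma blocks_charged:
  assumes F: "finite F" and e: "length e = 3 * N"
    and R: "\<And>i. i < N \<Longrightarrow> block_maj e ! i \<Longrightarrow> c \<le> card (F \<inter> R i) \<and> R i \<subseteq> near T (Wire t i)"
    and disj: "disjoint_family_on R {..<N}"
  shows "\<exists>E\<subseteq>{Wire t i | i. i < N}. wire_noise E t 0 N = block_maj e \<and> charged T c F E (\<Union>i<N. R i)"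
proof -
  define E where "E i = {w. w = Wire t i \<and> block_maj e ! i}" for i
  have "charged T c F (\<Union>i<N. E i) (\<Union>i<N. R i)"
  proof (rule charged_UN)
    fix i assume "i \<in> {..<N}"
    then show "charged T c F (E i) (R i)"
      using R[of i] F by (cases "block_maj e ! i") (auto simp: E_def intro!: charged_local)
  qed (use F disj in auto)
  moreover have "wire_noise (\<Union>i<N. E i) t 0 N = block_maj e"
    using e by (intro nth_equalityI) (auto simp: nth_wire_noise E_def)
  ultimately show ?thesis by (intro exI[of _ "\<Union>i<N. E i"]) (auto simp: E_def)
qed

lemma nth_block_maj_append:
  assumes "length xs = 3 * i" "length ys = 3"
  shows "block_maj (xs @ ys @ zs) ! i \<Longrightarrow> 2 \<le> weight ys"
proof -
  obtain a b c where "ys = [a, b, c]" using assms(2) by (rule length_3_cases)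
  then show "block_maj (xs @ ys @ zs) ! i \<Longrightarrow> 2 \<le> weight ys"
    using assms(1) by (auto simp: block_maj_append[of _ i] nth_append maj_def)
qed

text \<open>Input wires precede all layers and lie in no \<open>region\<close>, so their failures
  are charged separately, to the wires at time 0.\<close>

lemma input_charged:
  assumes F: "finite F" "charge_rate F c" and T: "T 0 = 0"
  shows "\<exists>E\<subseteq>{Wire 0 i | i. i < N}. wire_noise E 0 0 N = block_maj (wire_noise F 0 0 (3 * N)) \<and>
           charged T c F E (range (Wire 0))"
proof -
  define R where "R i = {Wire 0 (3 * i + k) | k. k < 3}" for i
  have c: "c \<le> 2" using F(2) by (auto simp: charge_rate_def)
  have "\<exists>E\<subseteq>{Wire 0 i | i. i < N}. wire_noise E 0 0 N = block_maj (wire_noise F 0 0 (3 * N)) \<and>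
      charged T c F E (\<Union>i<N. R i)"
  proof (rule blocks_charged[OF F(1)])
    fix i assume i: "i < N" "block_maj (wire_noise F 0 0 (3 * N)) ! i"
    have "3 * N = 3 * i + (3 + 3 * (N - i - 1))" using i by simp
    then have "2 \<le> weight (wire_noise F 0 (3 * i) 3)"
      using i(2) nth_block_maj_append[of "wire_noise F 0 0 (3 * i)" i "wire_noise F 0 (3 * i) 3"]
      by (simp only: wire_noise_add length_wire_noise add_0)
    also have "\<dots> = card {Wire 0 (3 * i + k) | k. k < 3 \<and> wire_noise F 0 (3 * i) 3 ! k}"
      by (rule card_wires[symmetric]) simp
    also have "\<dots> \<le> card (F \<inter> R i)"
      using F(1) by (intro card_mono) (auto simp: R_def nth_wire_noise)
    finally show "c \<le> card (F \<inter> R i) \<and> R i \<subseteq> near T (Wire 0 i)"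
      using c T by (auto simp: R_def)
  next
    have "3 * i + k = 3 * j + l \<Longrightarrow> k < 3 \<Longrightarrow> l < 3 \<Longrightarrow> i = j" for i j k l :: nat
      by presburger
    then show "disjoint_family_on R {..<N}"
      by (fastforce simp: disjoint_family_on_def R_def)
  qed simp
  then obtain E where "E \<subseteq> {Wire 0 i | i. i < N}"
    "wire_noise E 0 0 N = block_maj (wire_noise F 0 0 (3 * N))" "charged T c F E (\<Union>i<N. R i)"
    by blast
  then show ?thesis
    using charged_mono[of T c F E "\<Union>i<N. R i" "range (Wire 0)"] F(1) by (auto simp: R_def)
qed

text \<open>The noise of the last correction layer is not corrected any more; a block that it spoils
  is read as a flip of the simulated output wire.\<close>

lemma output_charged:
  assumes F: "finite F" "charge_rate F c" and T: "mono T" "T t < T (Suc t)"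
  shows "\<exists>E\<subseteq>{Wire t i | i. i < N}.
           wire_noise E t 0 N = block_maj (layer_noise F (T t) 0 (replicate N Z0)) \<and>
           charged T c F E (later (T t))"
proof -
  define R where "R i = region (T t) 1 (3 * i) 3" for i
  let ?e = "layer_noise F (T t) 0 (replicate N Z0)"
  have "\<exists>E\<subseteq>{Wire t i | i. i < N}. wire_noise E t 0 N = block_maj ?e \<and> charged T c F E (\<Union>i<N. R i)"
  proof (rule blocks_charged[OF F(1)])
    fix i assume i: "i < N" "block_maj ?e ! i"
    have "replicate N Z0 = replicate i Z0 @ [Z0] @ replicate (N - i - 1) Z0"
      using i(1) by (metis (no_types) Suc_diff_Suc Suc_eq_plus1 diff_Suc_1 diff_diff_left
          le_add_diff_inverse less_imp_le_nat replicate_0 replicate_Suc append_Cons append_Nil replicate_add)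
    then have "2 \<le> weight (layer_noise F (T t) (3 * i) [Z0])"
      using i(2) nth_block_maj_append[of "layer_noise F (T t) 0 (replicate i Z0)" i
          "layer_noise F (T t) (3 * i) [Z0]"]
      by (simp only: layer_noise_append length_layer_noise width_replicate width_simps arity.simps
          add_0 add_0_right mult.commute)
    then have "2 * 1 \<le> total_noise F (T t) (3 * i) [[Z0]]" by simp
    from charge_rate_le[OF F _ this, of 3] have "c \<le> card (F \<inter> R i)" by (simp add: R_def)
    moreover have "T (t - 1) \<le> T t" using T(1) by (auto simp: mono_def)
    ultimately show "c \<le> card (F \<inter> R i) \<and> R i \<subseteq> near T (Wire t i)"
      using T(2) by (fastforce simp: R_def region_def)
  next
    have "3 * i \<le> l \<Longrightarrow> l < 3 * i + 3 \<Longrightarrow> 3 * j \<le> l \<Longrightarrow> l < 3 * j + 3 \<Longrightarrow> i = j" for i j l :: nat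
      by presburger
    then show "disjoint_family_on R {..<N}"
      by (fastforce simp: disjoint_family_on_def R_def region_def)
  qed simp
  then obtain E where "E \<subseteq> {Wire t i | i. i < N}"
    "wire_noise E t 0 N = block_maj ?e" "charged T c F E (\<Union>i<N. R i)"
    by blast
  moreover have "(\<Union>i<N. R i) \<subseteq> later (T t)" by (auto simp: R_def region_def later_def)
  ultimately show ?thesis
    using charged_mono[of T c F E "\<Union>i<N. R i" "later (T t)"] F(1) by auto
qed

lemma FT_Cons: "FT P Q N (L # C) = (replicate N Z0 # simulate_layer P Q L) @ FT P Q N C"
  by (simp add: FT_def)

lemma width_FT:
  assumes P: "block_transposer P" and Q: "block_transposer Q" and C: "\<forall>L\<in>set C. width L = N"
  shows "\<forall>M\<in>set (FT P Q N C). width M = 3 * N"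
proof -
  have "width M = 3 * width L" if "M \<in> set (simulate_layer P Q L)" for M L
    using that width_corrected_layer[OF P Q, of "length (simulate_layer P Q L)" L]
    by (auto simp: corrected_layer_def simulate_layer_def)
  with C show ?thesis by (auto simp: FT_def)
qed

lemma or_bits_least: "xs \<preceq> zs \<Longrightarrow> ys \<preceq> zs \<Longrightarrow> xs \<curlyvee> ys \<preceq> zs"
  by (auto simp: list_all2_conv_all_nth nth_or_bits)

lemma le_or_bits2: "length xs = length ys \<Longrightarrow> ys \<preceq> xs \<curlyvee> ys"
  by (auto simp: list_all2_conv_all_nth nth_or_bits)

text \<open>The majorities read before a correction are both the output of the layer just treated
  and the input of the rest; monotonicity lets a bound on them be fed into the simulated remainder.
  This requires an arbitrary starting state \<open>y\<close> in the induction.\<close>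

lemma FT_charged_from:
  assumes P: "block_transposer P" and Q: "block_transposer Q"
    and F: "finite F" "charge_rate F c" and T: "strict_mono T" and N: "0 < N"
    and "unmixed N C" "length y = 3 * N"
    and "\<forall>k<length C. T (Suc (t + k)) = Suc (T (t + k) + length (simulate_layer P Q (C ! k)))"
  shows "\<exists>E\<subseteq>{Wire r i | r i. t \<le> r \<and> r \<le> t + length C \<and> i < N}.
           block_maj (noisy_run F (T t) 0 (FT P Q N C) y)
             \<preceq> noisy_run E t 0 C (block_maj y \<curlyvee> wire_noise E t 0 N) \<and>
           charged T c F E (later (T t))"
  using assms(7-9)
proof (induction C arbitrary: t y)
  case Nil
  have "T t < T (Suc t)" using T by (simp add: strict_mono_def)
  from output_charged[OF F strict_mono_mono[OF T] this, of N] obtain E where E: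
    "E \<subseteq> {Wire t i | i. i < N}" "charged T c F E (later (T t))"
    "wire_noise E t 0 N = block_maj (layer_noise F (T t) 0 (replicate N Z0))"
    by blast
  have "block_maj (noisy_run F (T t) 0 (FT P Q N []) y) = block_maj y \<curlyvee> wire_noise E t 0 N"
    using Nil.prems(2) E(3) by (simp add: FT_def run_layer_majorities[of y N] block_maj_rep3_or)
  then show ?case using E(1,2) by (intro exI[of _ E]) auto
next
  case (Cons L C)
  let ?l = "length (simulate_layer P Q L)"
  have L: "width L = N" "set L \<subseteq> {X0, Y0} \<or> set L \<subseteq> {Z0}" and C: "unmixed N C"
    using Cons.prems(1) by (auto simp: unmixed_def)
  have "L \<noteq> []" using L(1) N by auto
  note sim = simulate_layer_corrected[OF P Q L(2) this]
  have T1: "T (Suc t) = Suc (T t + ?l)" using Cons.prems(3)[rule_format, of 0] by simp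
  let ?D = "corrected_layer P Q ?l L"
  define y' where "y' = noisy_run F (T t) 0 ?D y"
  have wD: "\<forall>M\<in>set ?D. width M = length y"
    using width_corrected_layer[OF P Q, of ?l L] L(1) Cons.prems(2) by simp
  have ylen: "length y = 3 * width L" using Cons.prems(2) L(1) by simp
  have y': "length y' = 3 * N" using wD Cons.prems(2) by (simp add: y'_def)
  have run: "noisy_run F (T t) 0 (FT P Q N (L # C)) y = noisy_run F (T (Suc t)) 0 (FT P Q N C) y'"
    unfolding FT_Cons L(1)[symmetric] sim(1) noisy_run_append y'_def by (simp add: T1)
  obtain E1 where E1: "E1 \<subseteq> wire_block t 0 N" "charged T c F E1 (region (T t) (Suc ?l) 0 (3 * N))"
    "block_maj y' \<preceq> run_layer L (block_maj y \<curlyvee> wire_noise E1 t 0 N) \<curlyvee> wire_noise E1 (Suc t) 0 N"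
    using corrected_layer_charged[OF P Q F ylen strict_mono_mono[OF T] T1 sim(2), of 0,
        unfolded L(1) mult_0_right, folded y'_def]
    by blast
  have "\<forall>k<length C. T (Suc (Suc t + k)) = Suc (T (Suc t + k) + length (simulate_layer P Q (C ! k)))"
    using Cons.prems(3)[rule_format, of "Suc _"] by simp
  from Cons.IH[OF C y' this] obtain E2 where E2:
    "E2 \<subseteq> {Wire r i | r i. Suc t \<le> r \<and> r \<le> Suc t + length C \<and> i < N}"
    "block_maj (noisy_run F (T (Suc t)) 0 (FT P Q N C) y')
       \<preceq> noisy_run E2 (Suc t) 0 C (block_maj y' \<curlyvee> wire_noise E2 (Suc t) 0 N)"
    "charged T c F E2 (later (T (Suc t)))"
    by blast
  define E where "E = E1 \<union> E2"
  have sub: "E1 \<subseteq> E" "E2 \<subseteq> E" by (simp_all add: E_def)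
  have E: "E \<subseteq> {Wire r i | r i. t \<le> r \<and> r \<le> t + length (L # C) \<and> i < N}"
  proof
    fix w assume "w \<in> E"
    then have "w \<in> wire_block t 0 N \<or> w \<in> {Wire r i | r i. Suc t \<le> r \<and> r \<le> Suc t + length C \<and> i < N}"
      using E1(1) E2(1) by (auto simp: E_def)
    then show "w \<in> {Wire r i | r i. t \<le> r \<and> r \<le> t + length (L # C) \<and> i < N}"
      by (auto simp: wire_block_def)
  qed
  then have "wires_only E" by (auto simp: wires_only_def)
  let ?x = "run_layer L (block_maj y \<curlyvee> wire_noise E t 0 N) \<curlyvee> wire_noise E (Suc t) 0 N"
  have "block_maj y' \<preceq> ?x"
    using Cons.prems(2) L(1)
    by (intro le_bits_trans[OF E1(3)] or_bits_mono run_layer_mono wire_noise_mono sub le_bits_refl) simp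
  \<comment> \<open>Both \<open>E1\<close> and \<open>E2\<close> may flip wires at time
    \<open>Suc t\<close>. The simulated run has these flips only once, which suffices because they
    act as disjunctions.\<close>
  moreover have "wire_noise E2 (Suc t) 0 N \<preceq> ?x"
    using Cons.prems(2)
    by (intro le_bits_trans[OF wire_noise_mono[OF sub(2)] le_or_bits2]) simp
  ultimately have "block_maj y' \<curlyvee> wire_noise E2 (Suc t) 0 N \<preceq> ?x" by (rule or_bits_least)
  then have "noisy_run E2 (Suc t) 0 C (block_maj y' \<curlyvee> wire_noise E2 (Suc t) 0 N) \<preceq>
      noisy_run E (Suc t) 0 C ?x"
    using C y' by (intro noisy_run_mono sub) (auto simp: unmixed_def)
  also have "noisy_run E (Suc t) 0 C ?x = noisy_run E t 0 (L # C) (block_maj y \<curlyvee> wire_noise E t 0 N)"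
    using layer_noise_wires[OF \<open>wires_only E\<close>, of t 0 L] L(1) by simp
  finally have "block_maj (noisy_run F (T t) 0 (FT P Q N (L # C)) y) \<preceq>
      noisy_run E t 0 (L # C) (block_maj y \<curlyvee> wire_noise E t 0 N)"
    using E2(2) le_bits_trans unfolding run by blast
  moreover have "charged T c F E (later (T t))"
  proof -
    let ?R = "region (T t) (Suc ?l) 0 (3 * N)"
    have "charged T c F E (?R \<union> later (T (Suc t)))"
      unfolding E_def using F(1) by (intro charged_Un E1(2) E2(3)) (auto simp: region_def later_def T1)
    moreover have "?R \<union> later (T (Suc t)) \<subseteq> later (T t)"
      unfolding T1 by (fastforce simp: region_def later_def)
    ultimately show ?thesis using F(1) charged_mono by blast
  qed
  ultimately show ?case using E by blast
qed

text \<open>The outer \<open>Suc\<close> counts the correction layer. Past the end of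
  \<open>C\<close> the times go on in steps of 1; this keeps them strictly increasing and lets
  \<open>near\<close> include the wires after the last correction.\<close>

definition correction_time :: "circuit \<Rightarrow> circuit \<Rightarrow> circuit \<Rightarrow> nat \<Rightarrow> nat" where
  "correction_time P Q C t =
     (\<Sum>k<t. Suc (if k < length C then length (simulate_layer P Q (C ! k)) else 0))"

lemma strict_mono_correction_time: "strict_mono (correction_time P Q C)"
  by (simp add: strict_mono_Suc_iff correction_time_def)

lemma correction_time_Suc_le:
  assumes P: "block_transposer P" and Q: "block_transposer Q" and C: "unmixed N C" and N: "0 < N"
  shows "correction_time P Q C (Suc t) \<le> correction_time P Q C (t - 1) + 24"
proof -
  have "length (simulate_layer P Q (C ! k)) \<le> 11" if "k < length C" for k
  proof (rule simulate_layer_corrected(3)[OF P Q])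
    have "C ! k \<in> set C" using that by simp
    with C N show "set (C ! k) \<subseteq> {X0, Y0} \<or> set (C ! k) \<subseteq> {Z0}" "C ! k \<noteq> []"
      by (auto simp: unmixed_def)
  qed
  then have step: "correction_time P Q C (Suc t) \<le> correction_time P Q C t + 12" for t
    by (simp add: correction_time_def)
  show ?thesis using step[of t] step[of "t - 1"] by (cases t) auto
qed

lemma FT_charged:
  assumes P: "block_transposer P" and Q: "block_transposer Q"
    and F: "finite F" "charge_rate F c" and N: "0 < N" and C: "unmixed N C"
  defines "T \<equiv> correction_time P Q C"
  shows "\<exists>E\<subseteq>wires N C. block_maj (noisy_output F (3 * N) (FT P Q N C)) \<preceq> noisy_output E N C \<and>
           charged T c F E UNIV"
proof -
  let ?y = "wire_noise F 0 0 (3 * N)"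
  have T: "strict_mono T" "T 0 = 0" unfolding T_def
    by (rule strict_mono_correction_time) (simp add: correction_time_def)
  obtain E0 where E0: "E0 \<subseteq> {Wire 0 i | i. i < N}" "wire_noise E0 0 0 N = block_maj ?y"
    "charged T c F E0 (range (Wire 0))"
    using input_charged[where T = T, OF F T(2)] by blast
  have "\<forall>k<length C. T (Suc (0 + k)) = Suc (T (0 + k) + length (simulate_layer P Q (C ! k)))"
    by (simp add: T_def correction_time_def)
  note FT_charged_from[OF P Q F T(1) N C length_wire_noise this]
  from this[of F 0 0, unfolded T(2) add_0 add_0_right] obtain E1 where E1:
    "E1 \<subseteq> {Wire r i | r i. r \<le> length C \<and> i < N}"
    "block_maj (noisy_output F (3 * N) (FT P Q N C)) \<preceq> noisy_run E1 0 0 C (block_maj ?y \<curlyvee> wire_noise E1 0 0 N)"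
    "charged T c F E1 (later 0)"
    unfolding noisy_output_def by auto
  define E where "E = E0 \<union> E1"
  have "block_maj ?y \<curlyvee> wire_noise E1 0 0 N \<preceq> wire_noise E 0 0 N"
    unfolding E0(2)[symmetric] E_def by (intro or_bits_least wire_noise_mono) auto
  then have "noisy_run E1 0 0 C (block_maj ?y \<curlyvee> wire_noise E1 0 0 N) \<preceq> noisy_output E N C"
    unfolding noisy_output_def using C by (intro noisy_run_mono) (auto simp: E_def unmixed_def)
  then have "block_maj (noisy_output F (3 * N) (FT P Q N C)) \<preceq> noisy_output E N C"
    using E1(2) le_bits_trans by blast
  moreover have "charged T c F E UNIV"
  proof -
    have "charged T c F E (range (Wire 0) \<union> later 0)"
      unfolding E_def using F(1) by (intro charged_Un E0(3) E1(3)) (auto simp: later_def)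
    then show ?thesis using F(1) charged_mono by blast
  qed
  moreover have "E \<subseteq> wires N C" using E0(1) E1(1) by (auto simp: E_def wires_def)
  ultimately show ?thesis by blast
qed

section \<open>From the noise model to worst-case noise\<close>

fun position :: "circuit \<Rightarrow> component \<Rightarrow> component" where
  "position C (Wire t i) = Wire t i"
| "position C (Gadget t k) = Gadget t (width (take k (C ! t)))"

lemma width_take_Suc: "k < length L \<Longrightarrow> width (take (Suc k) L) = width (take k L) + arity (L ! k)"
  by (simp add: take_Suc_conv_app_nth)

lemma width_take_mono: "j \<le> k \<Longrightarrow> width (take j L) \<le> width (take k L)"
  using take_add[of j "k - j" L] by simp

lemma inj_on_position: "inj_on (position C) (circuit_components N C)"
proof -
  have less: "width (take j L) < width (take k L)" if "j < k" "k < length L" for j k and L :: layer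
    using width_take_Suc[of j L] width_take_mono[of "Suc j" k L] arity_pos[of "L ! j"] that by linarith
  have eq: "j = k" if "width (take j L) = width (take k L)" "j < length L" "k < length L" for j k and L :: layer
    using less[of j k L] less[of k j L] that by (cases j k rule: linorder_cases) auto
  show ?thesis
  proof (rule inj_onI)
    fix c d assume "c \<in> circuit_components N C" "d \<in> circuit_components N C" "position C c = position C d"
    then show "c = d"
      by (cases c; cases d) (auto simp: circuit_components_def wires_def gadgets_def intro: eq)
  qed
qed

lemma layer_noise_wire:
  "i < width L \<Longrightarrow> Wire (Suc s) (p + i) \<in> F \<Longrightarrow> layer_noise F s p L ! i"
proof (induction L arbitrary: i p)
  case (Cons g L)
  show ?case
  proof (cases "i < arity g")
    case True
    then show ?thesis using Cons.prems by (simp add: nth_append)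
  next
    case False
    then have "p + arity g + (i - arity g) = p + i" by simp
    then show ?thesis
      using Cons.IH[of "i - arity g" "p + arity g"] Cons.prems False by (simp add: nth_append)
  qed
qed simp

lemma layer_noise_gadget:
  assumes "k < length L" "i \<in> acts_on L k" "Gadget s (p + width (take k L)) \<in> F"
  shows "layer_noise F s p L ! i"
  using assms
proof (induction L arbitrary: i k p)
  case (Cons g L)
  show ?case
  proof (cases k)
    case 0
    then show ?thesis using Cons.prems by (simp add: nth_append acts_on_def)
  next
    case (Suc j)
    then have i: "arity g \<le> i" using Cons.prems(2) by (simp add: acts_on_def)
    have "i - arity g \<in> acts_on L j" using Cons.prems(2) Suc by (auto simp: acts_on_def)
    moreover have "Gadget s (p + arity g + width (take j L)) \<in> F"
      using Cons.prems(3) Suc by (simp add: add.assoc)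
    ultimately show ?thesis
      using Cons.IH[of j "i - arity g" "p + arity g"] Cons.prems(1) Suc i by (simp add: nth_append)
  qed
qed simp

lemma acts_on_covers: "i < width L \<Longrightarrow> \<exists>k<length L. i \<in> acts_on L k"
proof (induction L arbitrary: i)
  case (Cons g L)
  show ?case
  proof (cases "i < arity g")
    case True
    then show ?thesis by (intro exI[of _ 0]) (simp add: acts_on_def)
  next
    case False
    then have "i - arity g < width L" using Cons.prems by auto
    then obtain k where "k < length L" "i - arity g \<in> acts_on L k" using Cons.IH by blast
    then show ?thesis using False by (intro exI[of _ "Suc k"]) (auto simp: acts_on_def)
  qed
qed simp

text \<open>A deviating bit either was touched by a failing component, which
  \<open>layer_noise\<close> records, or is a correct gadget output, and correct layers commute with
  taking deviations.\<close>

lemma noisy_layer_deviation: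
  assumes "noisy_layer F t L v u" "noisy_wires F (Suc t) u v'" "length v = width L" "C ! t = L"
  shows "deviation b v' \<preceq> run_layer L (deviation b v) \<curlyvee> layer_noise (position C ` F) t 0 L"
proof -
  let ?F = "position C ` F"
  have len: "length v' = width L" "length u = width L"
    using assms(1-3) by (simp_all add: noisy_layer_def noisy_wires_def)
  have "run_layer L (deviation b v) ! i \<or> layer_noise ?F t 0 L ! i"
    if i: "i < width L" "v' ! i \<noteq> b" for i
  proof (cases "Wire (Suc t) i \<in> F")
    case True
    then have "Wire (Suc t) (0 + i) \<in> ?F" by force
    then show ?thesis using layer_noise_wire[OF i(1), of t 0 ?F] by blast
  next
    case False
    then have u: "u ! i \<noteq> b" using assms(2) i len by (simp add: noisy_wires_def)
    obtain k where k: "k < length L" "i \<in> acts_on L k" using acts_on_covers[OF i(1)] by blast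
    show ?thesis
    proof (cases "Gadget t k \<in> F")
      case True
      then have "position C (Gadget t k) \<in> ?F" by (rule imageI)
      then show ?thesis using layer_noise_gadget[OF k, of t 0 ?F] assms(4) by simp
    next
      case False
      then have "u ! i = run_layer L v ! i" using assms(1) k by (auto simp: noisy_layer_def)
      then show ?thesis using u i(1) assms(3) by (simp add: run_layer_deviation nth_deviation)
    qed
  qed
  then show ?thesis
    using len assms(3) by (auto simp: list_all2_conv_all_nth nth_or_bits nth_deviation)
qed

lemma possible_output_deviation:
  assumes out: "possible_output F C (replicate N b) y" and C: "\<forall>L\<in>set C. width L = N"
  shows "deviation b y \<preceq> noisy_output (position C ` F) N C"
proof -
  let ?F = "position C ` F"
  obtain u v where uv: "u 0 = replicate N b" "\<And>t. t \<le> length C \<Longrightarrow> noisy_wires F t (u t) (v t)"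
    "\<And>t. t < length C \<Longrightarrow> noisy_layer F t (C ! t) (v t) (u (Suc t))" "y = v (length C)"
    using out by (auto simp: possible_output_def)
  have len: "length (v t) = N" if "t \<le> length C" for t
    using that
  proof (induction t)
    case 0
    then show ?case using uv(1) uv(2)[of 0] by (simp add: noisy_wires_def)
  next
    case (Suc t)
    then show ?case using uv(2)[of "Suc t"] uv(3)[of t] by (simp add: noisy_wires_def noisy_layer_def)
  qed
  have "deviation b (v t) \<preceq> noisy_run ?F 0 0 (take t C) (wire_noise ?F 0 0 N)" if "t \<le> length C" for t
    using that
  proof (induction t)
    case 0
    have "Wire 0 i \<in> ?F" if "i < N" "v 0 ! i \<noteq> b" for i
    proof -
      have "Wire 0 i \<in> F" using uv(1) uv(2)[of 0] that by (auto simp: noisy_wires_def)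
      then have "position C (Wire 0 i) \<in> ?F" by (rule imageI)
      then show ?thesis by simp
    qed
    then show ?case
      using len[of 0] by (auto simp: list_all2_conv_all_nth nth_deviation nth_wire_noise)
  next
    case (Suc t)
    let ?L = "C ! t" and ?x = "noisy_run ?F 0 0 (take t C) (wire_noise ?F 0 0 N)"
    have t: "t < length C" using Suc.prems by simp
    then have w: "width ?L = N" using C by simp
    note [trans] = le_bits_trans
    have "deviation b (v (Suc t)) \<preceq> run_layer ?L (deviation b (v t)) \<curlyvee> layer_noise ?F t 0 ?L"
      using noisy_layer_deviation[OF uv(3)[OF t] uv(2)[OF Suc.prems] _ refl] len[of t] t w by simp
    also have "\<dots> \<preceq> run_layer ?L ?x \<curlyvee> layer_noise ?F t 0 ?L"
      using Suc.IH t len[of t] w by (intro or_bits_mono run_layer_mono le_bits_refl) simp_all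
    also have "\<dots> = noisy_run ?F 0 0 (take (Suc t) C) (wire_noise ?F 0 0 N)"
      using t by (simp add: take_Suc_conv_app_nth noisy_run_append)
    finally show ?case .
  qed
  from this[of "length C"] show ?thesis by (simp add: uv(4) noisy_output_def)
qed


section \<open>Decoding\<close>

lemma block_maj_take: "length xs = 3 * n \<Longrightarrow> k \<le> n \<Longrightarrow> block_maj (take (3 * k) xs) = take k (block_maj xs)"
  by (rule nth_equalityI) (auto simp: nth_block_maj[where n = n] nth_block_maj[where n = k])

lemma block_maj_drop: "length xs = 3 * n \<Longrightarrow> k \<le> n \<Longrightarrow> block_maj (drop (3 * k) xs) = drop k (block_maj xs)"
  by (rule nth_equalityI)
    (auto simp: nth_block_maj[where n = n] nth_block_maj[where n = "n - k"] algebra_simps diff_mult_distrib2)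

text \<open>The decoder recurses on the three large outer blocks, whereas the outermost
  \<open>FT\<close> in \<open>FTn\<close> is undone on blocks of three adjacent bits. Both orders
  give the same tree of majorities.\<close>

lemma decode_Suc_block_maj:
  "length xs = 3 ^ Suc n \<Longrightarrow> decode (Suc n) xs = decode n (block_maj xs)"
proof (induction n arbitrary: xs)
  case 0
  then obtain a b c where "xs = [a, b, c]" by (auto elim: length_3_cases)
  then show ?case by simp
next
  case (Suc n)
  let ?m = "3 ^ n :: nat"
  have xs: "length xs = 3 * (3 * ?m)" using Suc.prems by simp
  have "block_maj (take (3 * ?m) (drop (3 * (k * ?m)) xs)) = take ?m (drop (k * ?m) (block_maj xs))"
    if "k \<le> 2" for k
  proof -
    have "k = 0 \<or> k = 1 \<or> k = 2" using that by auto
    then have km: "?m \<le> 3 * ?m - k * ?m" "k * ?m \<le> 3 * ?m" by auto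
    have "length (drop (3 * (k * ?m)) xs) = 3 * (3 * ?m - k * ?m)"
      using xs by (simp add: diff_mult_distrib2)
    then show ?thesis by (simp only: block_maj_take[OF _ km(1)] block_maj_drop[OF xs km(2)])
  qed
  from this[of 0] this[of 1] this[of 2] have blocks:
    "block_maj (take (3 ^ Suc n) xs) = take ?m (block_maj xs)"
    "block_maj (take (3 ^ Suc n) (drop (3 ^ Suc n) xs)) = take ?m (drop ?m (block_maj xs))"
    "block_maj (take (3 ^ Suc n) (drop (2 * 3 ^ Suc n) xs)) = take ?m (drop (2 * ?m) (block_maj xs))"
    by (simp_all add: mult.left_commute)
  have "decode (Suc (Suc n)) xs = maj (decode (Suc n) (take (3 ^ Suc n) xs))
      (decode (Suc n) (take (3 ^ Suc n) (drop (3 ^ Suc n) xs)))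
      (decode (Suc n) (take (3 ^ Suc n) (drop (2 * 3 ^ Suc n) xs)))"
    by (rule decode.simps)
  also have "\<dots> = maj (decode n (take ?m (block_maj xs)))
      (decode n (take ?m (drop ?m (block_maj xs)))) (decode n (take ?m (drop (2 * ?m) (block_maj xs))))"
    using xs by (subst (1 2 3) Suc.IH) (simp_all only: blocks, auto)
  finally show ?case by simp
qed

lemma decode_mono:
  "length xs = 3 ^ n \<Longrightarrow> xs \<preceq> ys \<Longrightarrow> decode n xs \<Longrightarrow> decode n ys"
proof (induction n arbitrary: xs ys)
  case 0
  then show ?case by (auto simp: list_all2_conv_all_nth)
next
  case (Suc n)
  have "block_maj xs \<preceq> block_maj ys" using Suc.prems(2) by (rule block_maj_mono)
  moreover have "length ys = 3 ^ Suc n" using Suc.prems(1,2) list_all2_lengthD by fastforce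
  ultimately show ?case
    using Suc.IH[of "block_maj xs" "block_maj ys"] Suc.prems
    by (simp add: decode_Suc_block_maj del: decode.simps)
qed

lemma decode_deviation: "length xs = 3 ^ n \<Longrightarrow> decode n (deviation b xs) \<longleftrightarrow> decode n xs \<noteq> b"
proof (induction n arbitrary: xs)
  case 0
  then show ?case by (simp add: nth_deviation)
next
  case (Suc n)
  have "take k (deviation b ys) = deviation b (take k ys)" "drop k (deviation b ys) = deviation b (drop k ys)" for k ys
    by (simp_all add: deviation_def take_map drop_map)
  with Suc show ?case by (auto simp: maj_def)
qed


section \<open>Bounded error models\<close>

text \<open>At most 25 times, 15 positions and 2 components for each pair:
  \<open>25 * 15 * 2 = 750\<close>.\<close>

lemma card_near:
  assumes "\<And>t. T (Suc t) \<le> T (t - 1) + 24"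
  shows "finite (near T w)" "card (near T w) \<le> 750"
proof -
  show "finite (near T w)" by (cases w) auto
  show "card (near T w) \<le> 750"
  proof (cases w)
    case (Wire t i)
    have inner: "card (\<Union>j\<in>{3 * i - 6..<3 * i + 9}. {Wire s j, Gadget s j}) \<le> 15 * 2" for s
    proof -
      have "card (\<Union>j\<in>{3 * i - 6..<3 * i + 9}. {Wire s j, Gadget s j}) \<le>
          (\<Sum>j\<in>{3 * i - 6..<3 * i + 9}. card {Wire s j, Gadget s j})"
        by (rule card_UN_le) simp
      also have "\<dots> \<le> 15 * 2" by simp
      finally show ?thesis .
    qed
    have "card (near T w) \<le> (\<Sum>s\<in>{T (t - 1)..T (Suc t)}. card (\<Union>j\<in>{3 * i - 6..<3 * i + 9}. {Wire s j, Gadget s j}))"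
      unfolding Wire near.simps by (rule card_UN_le) simp
    also have "\<dots> \<le> card {T (t - 1)..T (Suc t)} * 30"
      using sum_bounded_above[of "{T (t - 1)..T (Suc t)}", OF inner] by simp
    also have "\<dots> \<le> 25 * 30" using assms[of t] by (intro mult_le_mono1) simp
    finally show ?thesis by simp
  qed simp
qed

lemma bounded_error_model_image:
  assumes \<mu>: "bounded_error_model K p \<mu>" and r: "inj_on r K" and p: "0 \<le> p"
  shows "bounded_error_model (r ` K) p (map_pmf ((`) r) \<mu>)"
  unfolding bounded_error_model_def
proof (intro conjI allI impI)
  show "set_pmf (map_pmf ((`) r) \<mu>) \<subseteq> Pow (r ` K)"
    using \<mu> by (auto simp: bounded_error_model_def)
  fix S assume "S \<subseteq> r ` K"
  then obtain S' where S': "S' \<subseteq> K" "S = r ` S'" by (auto simp: subset_image_iff)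
  have "{F. S \<subseteq> r ` F} \<inter> set_pmf \<mu> \<subseteq> {F. S' \<subseteq> F}"
  proof
    fix F assume F: "F \<in> {F. S \<subseteq> r ` F} \<inter> set_pmf \<mu>"
    then have "F \<subseteq> K" using \<mu> by (auto simp: bounded_error_model_def)
    with F S' show "F \<in> {F. S' \<subseteq> F}" using inj_on_image_subset_iff[OF r] by auto
  qed
  then have "measure_pmf.prob \<mu> {F. S \<subseteq> r ` F} \<le> measure_pmf.prob \<mu> {F. S' \<subseteq> F}"
    by (metis measure_Int_set_pmf measure_pmf.finite_measure_mono sets_measure_pmf UNIV_I)
  also have "\<dots> \<le> p ^ card S'" using \<mu> S' by (simp add: bounded_error_model_def)
  also have "card S' = card S" using S' r by (metis card_image inj_on_subset)
  finally show "measure_pmf.prob (map_pmf ((`) r) \<mu>) {F. S \<subseteq> F} \<le> p ^ card S"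
    by (simp add: vimage_def)
qed

lemma bounded_error_model_mono:
  "bounded_error_model K p \<mu> \<Longrightarrow> 0 \<le> p \<Longrightarrow> p \<le> q \<Longrightarrow> bounded_error_model K q \<mu>"
  unfolding bounded_error_model_def by (meson order_trans power_mono)

text \<open>
  The failure of all wires in \<open>W\<close> forces \<open>c * card W\<close> failures in the neighbourhood of \<open>W\<close>, which
  has at most \<open>m * card W\<close> elements; this leaves at most \<open>2 ^ (m * card W)\<close> sets for the union bound.
\<close>

lemma bounded_error_model_charged:
  assumes \<mu>: "bounded_error_model K p \<mu>" and p: "0 \<le> p" and K': "finite K'"
    and near: "\<And>w. finite (near T w) \<and> card (near T w) \<le> m"
    and f: "\<And>F. F \<in> set_pmf \<mu> \<Longrightarrow> finite F \<and> f F \<subseteq> K' \<and> charged T c F (f F) UNIV"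
  shows "bounded_error_model K' (2 ^ m * p ^ c) (map_pmf f \<mu>)"
  unfolding bounded_error_model_def
proof (intro conjI allI impI)
  show "set_pmf (map_pmf f \<mu>) \<subseteq> Pow K'" using f by auto
  fix W assume "W \<subseteq> K'"
  then have W: "finite W" using K' finite_subset by blast
  define N where "N = (\<Union>w\<in>W. near T w)"
  define \<S> where "\<S> = {S. S \<subseteq> K \<inter> N \<and> card S = c * card W}"
  have N: "finite N" "card N \<le> m * card W"
  proof -
    show "finite N" using W near by (simp add: N_def)
    have "card N \<le> (\<Sum>w\<in>W. card (near T w))" unfolding N_def by (rule card_UN_le[OF W])
    also have "\<dots> \<le> m * card W" using sum_bounded_above[of W "\<lambda>w. card (near T w)" m] near by (simp add: mult.commute)
    finally show "card N \<le> m * card W" .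
  qed
  have "\<S> \<subseteq> Pow N" by (auto simp: \<S>_def)
  then have \<S>: "finite \<S>" "card \<S> \<le> 2 ^ (m * card W)"
  proof -
    show "finite \<S>" using \<open>\<S> \<subseteq> Pow N\<close> N(1) finite_subset by auto
    have "card \<S> \<le> 2 ^ card N" using card_mono[OF _ \<open>\<S> \<subseteq> Pow N\<close>] N(1) by (simp add: card_Pow)
    also have "\<dots> \<le> 2 ^ (m * card W)" using N(2) by (intro power_increasing) simp_all
    finally show "card \<S> \<le> 2 ^ (m * card W)" .
  qed
  have "{F. W \<subseteq> f F} \<inter> set_pmf \<mu> \<subseteq> (\<Union>S\<in>\<S>. {F. S \<subseteq> F})"
  proof
    fix F assume "F \<in> {F. W \<subseteq> f F} \<inter> set_pmf \<mu>"
    then have F: "W \<subseteq> f F" "F \<in> set_pmf \<mu>" by auto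
    have "F \<subseteq> K" using F(2) \<mu> by (auto simp: bounded_error_model_def)
    have "c * card W \<le> card (F \<inter> N)" using f[OF F(2)] F(1) by (auto simp: charged_def N_def)
    \<comment> \<open>Cutting down to exactly \<open>c * card W\<close> faults gives all terms of
      the union bound the same estimate.\<close>
    then obtain S where "S \<subseteq> F \<inter> N" "card S = c * card W" by (rule obtain_subset_with_card_n)
    with \<open>F \<subseteq> K\<close> show "F \<in> (\<Union>S\<in>\<S>. {F. S \<subseteq> F})" by (auto simp: \<S>_def)
  qed
  then have "measure_pmf.prob \<mu> {F. W \<subseteq> f F} \<le> measure_pmf.prob \<mu> (\<Union>S\<in>\<S>. {F. S \<subseteq> F})"
    by (metis measure_Int_set_pmf measure_pmf.finite_measure_mono sets_measure_pmf UNIV_I)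
  also have "\<dots> \<le> (\<Sum>S\<in>\<S>. measure_pmf.prob \<mu> {F. S \<subseteq> F})"
    by (rule measure_UNION_le[OF \<S>(1)]) simp
  also have "\<dots> \<le> (\<Sum>S\<in>\<S>. p ^ (c * card W))"
    using \<mu> by (intro sum_mono) (auto simp: \<S>_def bounded_error_model_def)
  also have "\<dots> \<le> 2 ^ (m * card W) * p ^ (c * card W)"
    using of_nat_mono[OF \<S>(2), where 'a = real] p by (simp add: mult_right_mono)
  also have "\<dots> = (2 ^ m * p ^ c) ^ card W" by (simp add: power_mult_distrib power_mult)
  finally show "measure_pmf.prob (map_pmf f \<mu>) {F. W \<subseteq> F} \<le> (2 ^ m * p ^ c) ^ card W"
    by (simp add: vimage_def)
qed

section \<open>The simulated idle circuit\<close>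

abbreviation idle :: "nat \<Rightarrow> circuit" where
  "idle T \<equiv> replicate T [X0]"

definition union_factor :: real where
  "union_factor = 2 ^ 750"

lemma union_factor_ge_1: "1 \<le> union_factor"
  unfolding union_factor_def by (rule one_le_power) simp

lemma finite_wires: "finite (wires N C)"
proof -
  have "wires N C \<subseteq> (\<lambda>(t, i). Wire t i) ` ({..length C} \<times> {..<N})"
    by (auto simp: wires_def)
  then show ?thesis by (rule finite_subset) auto
qed

lemma finite_gadgets: "finite (gadgets C)"
proof -
  have "gadgets C = (\<lambda>(t, k). Gadget t k) ` (SIGMA t:{..<length C}. {..<length (C ! t)})"
    by (auto simp: gadgets_def)
  then show ?thesis by simp
qed

lemma length_noisy_output: "\<forall>L\<in>set C. width L = N \<Longrightarrow> length (noisy_output F N C) = N"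
  by (simp add: noisy_output_def)

lemma unmixed_FTn:
  assumes P: "block_transposer P" and Q: "block_transposer Q"
  shows "unmixed (3 ^ n) (FTn P Q n 1 (idle T))"
proof -
  have "\<forall>L\<in>set (FTn P Q n 1 (idle T)). width L = 3 ^ n"
  proof (induction n)
    case (Suc n)
    then show ?case using width_FT[OF P Q] by simp
  qed simp
  then show ?thesis using FTn_layers_unmixed[OF P Q] by (auto simp: unmixed_def)
qed

text \<open>The explanation is chosen as a function \<open>f\<close> of the fault set, so the law of
  the simulated errors is an image of \<open>\<mu>\<close> and levels can be composed.\<close>

lemma bounded_error_model_FT:
  assumes P: "block_transposer P" and Q: "block_transposer Q" and N: "0 < N" and C: "unmixed N C"
    and \<mu>: "bounded_error_model K p \<mu>" "0 \<le> p"
    and rate: "\<And>F. F \<in> set_pmf \<mu> \<Longrightarrow> finite F \<and> charge_rate F c"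
  shows "\<exists>f. bounded_error_model (wires N C) (union_factor * p ^ c) (map_pmf f \<mu>) \<and>
           (\<forall>F\<in>set_pmf \<mu>. block_maj (noisy_output F (3 * N) (FT P Q N C)) \<preceq> noisy_output (f F) N C)"
proof -
  let ?T = "correction_time P Q C"
  have "\<forall>F\<in>set_pmf \<mu>. \<exists>E\<subseteq>wires N C.
      block_maj (noisy_output F (3 * N) (FT P Q N C)) \<preceq> noisy_output E N C \<and> charged ?T c F E UNIV"
    using FT_charged[OF P Q _ _ N C] rate by blast
  then obtain f where f: "\<And>F. F \<in> set_pmf \<mu> \<Longrightarrow> f F \<subseteq> wires N C \<and>
      block_maj (noisy_output F (3 * N) (FT P Q N C)) \<preceq> noisy_output (f F) N C \<and> charged ?T c F (f F) UNIV"
    by metis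
  have "bounded_error_model (wires N C) (2 ^ 750 * p ^ c) (map_pmf f \<mu>)"
    using card_near[of ?T, OF correction_time_Suc_le[OF P Q C N]] f rate
    by (intro bounded_error_model_charged[OF \<mu> finite_wires, where T = ?T]) blast+
  then show ?thesis using f unfolding union_factor_def by blast
qed

text \<open>The bound is the closed form of iterating \<open>q\<close> to
  \<open>union_factor * q ^ 2\<close>; the division makes the case \<open>m = 0\<close>
  exact.\<close>

lemma bounded_error_model_FTn:
  assumes P: "block_transposer P" and Q: "block_transposer Q"
    and "bounded_error_model (wires (3 ^ m) (FTn P Q m 1 (idle T))) q \<mu>" "0 \<le> q"
  shows "\<exists>f. bounded_error_model (wires 1 (idle T)) ((union_factor * q) ^ 2 ^ m / union_factor) (map_pmf f \<mu>) \<and>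
           (\<forall>F\<in>set_pmf \<mu>. decode m (noisy_output F (3 ^ m) (FTn P Q m 1 (idle T))) \<longrightarrow>
              noisy_output (f F) 1 (idle T) ! 0)"
  using assms(3,4)
proof (induction m arbitrary: \<mu> q)
  case 0
  then show ?case using union_factor_ge_1 by (intro exI[of _ id]) (simp add: map_pmf_id[unfolded id_def] id_def)
next
  case (Suc m)
  let ?C = "FTn P Q m 1 (idle T)" and ?D = "FTn P Q (Suc m) 1 (idle T)"
  have C: "unmixed (3 ^ m) ?C" by (rule unmixed_FTn[OF P Q])
  have D: "?D = FT P Q (3 ^ m) ?C" by simp
  have rate: "finite F \<and> charge_rate F 2" if "F \<in> set_pmf \<mu>" for F
  proof -
    have F: "F \<subseteq> wires (3 ^ Suc m) ?D" using Suc.prems(1) that by (auto simp: bounded_error_model_def)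
    then have "wires_only F" by (auto simp: wires_only_def wires_def)
    then show ?thesis using finite_subset[OF F finite_wires] by (simp add: charge_rate_def)
  qed
  have "(0::nat) < 3 ^ m" by simp
  from bounded_error_model_FT[OF P Q this C Suc.prems rate] obtain f where f:
    "bounded_error_model (wires (3 ^ m) ?C) (union_factor * q ^ 2) (map_pmf f \<mu>)"
    "\<forall>F\<in>set_pmf \<mu>. block_maj (noisy_output F (3 ^ Suc m) ?D) \<preceq> noisy_output (f F) (3 ^ m) ?C"
    unfolding D by auto
  have "0 \<le> union_factor * q ^ 2" using union_factor_ge_1 by simp
  from Suc.IH[OF f(1) this] obtain g where g:
    "bounded_error_model (wires 1 (idle T)) ((union_factor * (union_factor * q ^ 2)) ^ 2 ^ m / union_factor)
       (map_pmf g (map_pmf f \<mu>))"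
    "\<forall>F\<in>set_pmf (map_pmf f \<mu>). decode m (noisy_output F (3 ^ m) ?C) \<longrightarrow> noisy_output (g F) 1 (idle T) ! 0"
    by blast
  have "(union_factor * (union_factor * q ^ 2)) ^ 2 ^ m = (union_factor * q) ^ 2 ^ Suc m"
    by (simp add: power_mult power2_eq_square mult_ac)
  moreover have "noisy_output (g (f F)) 1 (idle T) ! 0"
    if F: "F \<in> set_pmf \<mu>" and dec: "decode (Suc m) (noisy_output F (3 ^ Suc m) ?D)" for F
  proof -
    let ?y = "noisy_output F (3 ^ Suc m) ?D"
    have len: "length ?y = 3 ^ Suc m"
      using unmixed_FTn[OF P Q, of "Suc m" T] by (intro length_noisy_output) (auto simp: unmixed_def)
    have "decode m (block_maj ?y)" using dec decode_Suc_block_maj[OF len] by blast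
    then have "decode m (noisy_output (f F) (3 ^ m) ?C)"
      using decode_mono[of "block_maj ?y" m] f(2) F len by simp
    then show ?thesis using g(2) F by simp
  qed
  ultimately show ?case
    using g(1) by (intro exI[of _ "g \<circ> f"]) (simp add: map_pmf_comp o_def del: FTn.simps decode.simps)
qed

lemma noisy_output_idle_empty: "noisy_output {} 1 (idle T) = [False]"
proof -
  have "noisy_run {} s 0 (idle T) [False] = [False]" for s
    by (induction T arbitrary: s) auto
  then show ?thesis by (simp add: noisy_output_def wire_noise_def)
qed

text \<open>Failing wires may also behave well, so one failing wire admits both outputs: no flip, or
  a single flip there.\<close>

lemma possible_output_idle:
  assumes E: "E \<subseteq> wires 1 (idle T)" and z: "z = b \<or> E \<noteq> {}"
  shows "possible_output E (idle T) [b] [z]"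
proof (cases "z = b")
  case True
  then show ?thesis unfolding possible_output_def
    by (intro exI[of _ "\<lambda>_. [b]"]) (auto simp: noisy_wires_def noisy_layer_def)
next
  case False
  then obtain r where r: "Wire r 0 \<in> E" "r \<le> T" using E z by (auto simp: wires_def)
  define u v where "u t = [if t \<le> r then b else z]" and "v t = [if t < r then b else z]" for t
  have "noisy_wires E t (u t) (v t)" for t
    using r(1) by (cases "t = r") (auto simp: noisy_wires_def u_def v_def)
  moreover have "noisy_layer E t [X0] (v t) (u (Suc t))" for t
    by (auto simp: noisy_layer_def u_def v_def)
  ultimately show ?thesis unfolding possible_output_def
    using r(2) by (intro exI[of _ u] exI[of _ v]) (auto simp: u_def v_def)
qed

theorem corollary2p1:
  fixes P Q :: circuit
  assumes "block_transposer P" and "block_transposer Q"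
  shows "\<exists>A::real. \<forall>n T :: nat. \<forall>p::real.
    n \<ge> 1 \<longrightarrow> T \<ge> 1 \<longrightarrow> 0 \<le> p \<longrightarrow> p \<le> 1 \<longrightarrow>
    (\<forall>\<mu> :: component set pmf.
       bounded_error_model (circuit_components (3 ^ n) (FTn P Q n 1 (replicate T [X0]))) p \<mu> \<longrightarrow>
       experiences_wire_error_model P Q n (replicate T [X0]) \<mu> ((A * p) ^ (2 ^ (n - 1))))"
proof (intro exI allI impI)
  fix n T :: nat and p :: real and \<mu> :: "component set pmf"
  assume "n \<ge> 1" and p: "0 \<le> p"
    and \<mu>: "bounded_error_model (circuit_components (3 ^ n) (FTn P Q n 1 (idle T))) p \<mu>"
  define m where "m = n - 1"
  have n: "n = Suc m" using \<open>n \<ge> 1\<close> by (simp add: m_def)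
  let ?C = "FTn P Q m 1 (idle T)" and ?D = "FTn P Q n 1 (idle T)"
  let ?K = "circuit_components (3 ^ n) ?D"
  define q where "q = union_factor * p"
  have D: "?D = FT P Q (3 ^ m) ?C" by (simp add: n)
  have n3: "3 ^ n = 3 * (3::nat) ^ m" by (simp add: n)
  have widths: "\<forall>L\<in>set ?D. width L = 3 ^ n"
    using unmixed_FTn[OF assms, of n T] by (simp add: unmixed_def)
  have "finite ?K" by (simp add: circuit_components_def finite_wires finite_gadgets)
  then have fin: "finite F" if "F \<in> set_pmf \<mu>" for F
    using \<mu> that finite_subset by (auto simp: bounded_error_model_def)
  let ?pos = "(`) (position ?D)"
  note \<mu>1 = bounded_error_model_image[OF \<mu> inj_on_position p]
  have "(0::nat) < 3 ^ m" by simp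
  have C: "unmixed (3 ^ m) ?C" by (rule unmixed_FTn[OF assms])
  have rate: "finite F \<and> charge_rate F 1" if "F \<in> set_pmf (map_pmf ?pos \<mu>)" for F
    using that fin by (auto simp: charge_rate_def)
  from bounded_error_model_FT[OF assms \<open>0 < 3 ^ m\<close> C \<mu>1 p rate] obtain f where f':
    "bounded_error_model (wires (3 ^ m) ?C) (union_factor * p ^ 1) (map_pmf f (map_pmf ?pos \<mu>))"
    "\<forall>F\<in>set_pmf (map_pmf ?pos \<mu>).
       block_maj (noisy_output F (3 * 3 ^ m) (FT P Q (3 ^ m) ?C)) \<preceq> noisy_output (f F) (3 ^ m) ?C"
    by blast
  have f1: "bounded_error_model (wires (3 ^ m) ?C) q (map_pmf f (map_pmf ?pos \<mu>))"
    using f'(1) by (simp only: q_def power_one_right)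
  have f2: "block_maj (noisy_output (?pos F) (3 ^ n) ?D) \<preceq> noisy_output (f (?pos F)) (3 ^ m) ?C"
    if "F \<in> set_pmf \<mu>" for F
  proof -
    have "?pos F \<in> set_pmf (map_pmf ?pos \<mu>)" using that by simp
    from bspec[OF f'(2) this] show
      "block_maj (noisy_output (?pos F) (3 ^ n) ?D) \<preceq> noisy_output (f (?pos F)) (3 ^ m) ?C"
      by (simp only: D[symmetric] n3)
  qed
  have q: "0 \<le> q" using p union_factor_ge_1 by (simp add: q_def)
  obtain g where g:
    "bounded_error_model (wires 1 (idle T)) ((union_factor * q) ^ 2 ^ m / union_factor)
       (map_pmf g (map_pmf f (map_pmf ?pos \<mu>)))"
    "\<forall>F\<in>set_pmf \<mu>. decode m (noisy_output (f (?pos F)) (3 ^ m) ?C) \<longrightarrow> noisy_output (g (f (?pos F))) 1 (idle T) ! 0"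
    using bounded_error_model_FTn[OF assms f1 q] by auto
  define E where "E F = g (f (?pos F))" for F
  \<comment> \<open>The coupling is deterministic: the simulated errors are a function of the
    faults.\<close>
  define \<nu> where "\<nu> = map_pmf (\<lambda>F. (F, E F)) \<mu>"
  have snd: "map_pmf snd \<nu> = map_pmf g (map_pmf f (map_pmf ?pos \<mu>))"
    by (simp add: \<nu>_def E_def map_pmf_comp)
  \<comment> \<open>One factor of the constant comes from the first level, through \<open>q\<close>,
    the other from the levels of squaring.\<close>
  have "(union_factor * q) ^ 2 ^ m / union_factor \<le> (union_factor * q) ^ 2 ^ m / 1"
    using union_factor_ge_1 q by (intro divide_left_mono) simp_all
  also have "\<dots> = (union_factor * union_factor * p) ^ 2 ^ (n - 1)"
    by (simp add: n q_def mult.assoc)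
  finally have "(union_factor * q) ^ 2 ^ m / union_factor \<le> (union_factor * union_factor * p) ^ 2 ^ (n - 1)" .
  then have bounded: "bounded_error_model (wires 1 (idle T)) ((union_factor * union_factor * p) ^ 2 ^ (n - 1)) (map_pmf snd \<nu>)"
    unfolding snd using union_factor_ge_1 q by (intro bounded_error_model_mono[OF g(1)]) auto
  have "possible_output (E F) (idle T) [b] [decode n y]"
    if F: "F \<in> set_pmf \<mu>" and y: "possible_output F ?D (replicate (3 ^ n) b) y" for F b y
  proof (rule possible_output_idle)
    show "E F \<subseteq> wires 1 (idle T)"
    proof -
      have "E F \<in> set_pmf (map_pmf snd \<nu>)" using F by (force simp: \<nu>_def map_pmf_comp)
      then show ?thesis using bounded unfolding bounded_error_model_def by blast
    qed
    let ?y = "noisy_output (?pos F) (3 ^ n) ?D"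
    have dev: "deviation b y \<preceq> ?y" by (rule possible_output_deviation[OF y widths])
    have len: "length ?y = 3 ^ n" by (rule length_noisy_output[OF widths])
    have len': "length y = 3 ^ n" using list_all2_lengthD[OF dev] len by simp
    \<comment> \<open>The explanation bounds deviations only from above, so the simulated run need
      not reproduce the decoded bit; on an idle line it suffices that a decoding error forces some
      failing wire.\<close>
    show "decode n y = b \<or> E F \<noteq> {}"
    proof (rule disj_imp[THEN iffD2, OF impI])
      assume "decode n y \<noteq> b"
      then have "decode n ?y"
        using decode_deviation[OF len', of b] decode_mono[OF _ dev] len' by simp
      then have "decode m (block_maj ?y)" using decode_Suc_block_maj[of ?y m] len n by simp
      then have "decode m (noisy_output (f (?pos F)) (3 ^ m) ?C)"
        using decode_mono[of "block_maj ?y" m] f2[OF F] len n by simp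
      then have "noisy_output (E F) 1 (idle T) ! 0" using g(2) F by (simp add: E_def)
      then show "E F \<noteq> {}" using noisy_output_idle_empty by fastforce
    qed
  qed
  then show "experiences_wire_error_model P Q n (idle T) \<mu> ((union_factor * union_factor * p) ^ 2 ^ (n - 1))"
    unfolding experiences_wire_error_model_def using bounded
    by (intro exI[of _ \<nu>]) (auto simp: \<nu>_def map_pmf_comp)
qed

end
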